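(* Assume $\kappa=\kappa^{<\kappa}$. For every point $x$ of $S_\kappa$, the Stone–Čech compactification $\beta(S_\kappa\setminus\{x\})$ is a $\kappa$-Parovičenko space of weight $2^\kappa$.
   Context: A space is zero-dimensional if it has a base of clopen sets. For a zero-dimensional space $X$ and an open $U\subseteq X$, the ($X$-)type $\tau(U)$ is the least cardinal $\tau$ such that $U$ is a union of $\tau$ many clopen subsets of $X$. A zero-dimensional space is an $F_\kappa$-space if every open subset of type less than $\kappa$ is $C^*$-embedded (every bounded continuous real-valued function on it extends continuously to the whole space). A space is a $G_\kappa$-space if every non-empty intersection of fewer than $\kappa$ open sets has non-empty interior. A $\kappa$-Parovičenko space is a compact Hausdorff zero-dimensional $F_\kappa$- and $G_\kappa$-space without isolated points (no weight restriction is imposed). If $\kappa=\kappa^{<\kappa}$ there is, up to homeomorphism, a unique $\kappa$-Parovičenko space of weight $\kappa$; it is denoted $S_\kappa$. *)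

theory Defs
  imports "HOL-Analysis.Analysis"
begin

text \<open>Cardinals are represented by sets: the cardinal kappa is the cardinality of a set K,
  and comparisons use the library's cardinal orders ordLeq2 / ordLess2 / ordIso2
  applied to card_of.\<close>

text \<open>kappa to the power less than kappa, realised as the set of all functions from a subset
  of K of cardinality less than |K| into K (partial maps with such domains).\<close>
definition lt_power :: "'k set \<Rightarrow> ('k \<rightharpoonup> 'k) set" where
  "lt_power K = {f. dom f \<subseteq> K \<and> ran f \<subseteq> K \<and> ordLess2 (card_of (dom f)) (card_of K)}"

definition is_base :: "'a topology \<Rightarrow> 'a set set \<Rightarrow> bool" where
  "is_base X B \<longleftrightarrow> (\<forall>b\<in>B. openin X b) \<and> (\<forall>U. openin X U \<longrightarrow> (\<exists>\<C>\<subseteq>B. \<Union>\<C> = U))"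

definition clopenin :: "'a topology \<Rightarrow> 'a set \<Rightarrow> bool" where
  "clopenin X U \<longleftrightarrow> openin X U \<and> closedin X U"

definition zero_dimensional :: "'a topology \<Rightarrow> bool" where
  "zero_dimensional X \<longleftrightarrow> (\<exists>B. is_base X B \<and> (\<forall>b\<in>B. clopenin X b))"

definition weight_is :: "'a topology \<Rightarrow> 'k set \<Rightarrow> bool" where
  "weight_is X K \<longleftrightarrow> (\<exists>B. is_base X B \<and> ordLeq2 (card_of B) (card_of K)) \<and>
                      (\<forall>B. is_base X B \<longrightarrow> ordLeq2 (card_of K) (card_of B))"

definition type_less :: "'a topology \<Rightarrow> 'a set \<Rightarrow> 'k set \<Rightarrow> bool" where
  "type_less X U K \<longleftrightarrow> (\<exists>\<C>. (\<forall>C\<in>\<C>. clopenin X C) \<and> \<Union>\<C> = U \<and> ordLess2 (card_of \<C>) (card_of K))"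

definition C_star_embedded :: "'a topology \<Rightarrow> 'a set \<Rightarrow> bool" where
  "C_star_embedded X S \<longleftrightarrow>
     (\<forall>f. continuous_map (subtopology X S) euclideanreal f \<and> bounded (f ` (topspace X \<inter> S)) \<longrightarrow>
        (\<exists>g. continuous_map X euclideanreal g \<and> (\<forall>x\<in>topspace X \<inter> S. g x = f x)))"

definition F_kappa_space :: "'k set \<Rightarrow> 'a topology \<Rightarrow> bool" where
  "F_kappa_space K X \<longleftrightarrow> zero_dimensional X \<and>
     (\<forall>U. openin X U \<and> type_less X U K \<longrightarrow> C_star_embedded X U)"

definition G_kappa_space :: "'k set \<Rightarrow> 'a topology \<Rightarrow> bool" where
  "G_kappa_space K X \<longleftrightarrow>
     (\<forall>\<U>. (\<forall>U\<in>\<U>. openin X U) \<and> ordLess2 (card_of \<U>) (card_of K) \<and> topspace X \<inter> \<Inter>\<U> \<noteq> {}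
          \<longrightarrow> X interior_of (topspace X \<inter> \<Inter>\<U>) \<noteq> {})"

definition kappa_Parovicenko :: "'k set \<Rightarrow> 'a topology \<Rightarrow> bool" where
  "kappa_Parovicenko K X \<longleftrightarrow> compact_space X \<and> Hausdorff_space X \<and> zero_dimensional X \<and>
     F_kappa_space K X \<and> G_kappa_space K X \<and> (\<forall>x\<in>topspace X. \<not> openin X {x})"

text \<open>Stone-Cech compactification (Cech's construction): the closure of the image of Y
  under the evaluation map into the cube [0,1]^I, I = continuous maps Y \<rightarrow> [0,1]
  (taken extensional, i.e. undefined outside topspace Y).\<close>
definition stone_cech :: "'a topology \<Rightarrow> (('a \<Rightarrow> real) \<Rightarrow> real) topology" where
  "stone_cech Y =
     (let I = {f. continuous_map Y (top_of_set {0..1::real}) f \<and> f \<in> extensional (topspace Y)};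
          P = product_topology (\<lambda>_. top_of_set {0..1::real}) I
      in subtopology P (P closure_of ((\<lambda>y. restrict (\<lambda>f. f y) I) ` topspace Y)))"

end

theory Submission
  imports Defs "HOL-Library.Countable_Set_Type"
begin

text \<open>
  Write \<open>Y = X - {x}\<close>. It is covered by \<open>\<kappa>\<close> many clopen subsets \<open>C a\<close> of \<open>X\<close>, and in \<open>X\<close> disjoint
  open sets of type \<open>< \<kappa>\<close> can be separated by a clopen set. By transfinite recursion along the cover,
  disjoint open sets of \<open>Y\<close> whose traces on every \<open>C a\<close> have type \<open>< \<kappa>\<close> are therefore separated by a
  clopen set of \<open>Y\<close>. Applied to level sets of a continuous function, this makes \<open>\<beta>Y\<close>
  zero-dimensional, with the same clopen algebra as \<open>Y\<close>; applied to unions of \<open>< \<kappa>\<close> many clopen sets,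
  it gives the \<open>F\<^sub>\<kappa>\<close>-property of \<open>\<beta>Y\<close>; applied to a disjoint family of \<open>\<kappa>\<close> many clopen sets, which
  exists because \<open>x\<close> is not isolated and \<open>X\<close> is a \<open>G\<^sub>\<kappa>\<close>-space, it produces \<open>2\<^sup>\<kappa>\<close> many clopen sets.
  The \<open>G\<^sub>\<kappa>\<close>-property of \<open>\<beta>Y\<close> follows from the fact that fewer than \<open>\<kappa>\<close> many clopen subsets of \<open>Y\<close>
  with the finite intersection property have a common point in \<open>Y\<close>.
\<close>

context
  includes cardinal_syntax
begin

subsection \<open>Clopen sets and small types\<close>

lemma clopenin_Un: "clopenin X A \<Longrightarrow> clopenin X B \<Longrightarrow> clopenin X (A \<union> B)"
  by (auto simp: clopenin_def)

lemma clopenin_Int: "clopenin X A \<Longrightarrow> clopenin X B \<Longrightarrow> clopenin X (A \<inter> B)"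
  by (auto simp: clopenin_def)

lemma clopenin_Diff: "clopenin X A \<Longrightarrow> clopenin X B \<Longrightarrow> clopenin X (A - B)"
  by (auto simp: clopenin_def closedin_diff openin_diff)

lemma clopenin_empty [simp]: "clopenin X {}"
  by (auto simp: clopenin_def)

lemma clopenin_topspace [simp]: "clopenin X (topspace X)"
  by (auto simp: clopenin_def)

lemma clopenin_subset: "clopenin X A \<Longrightarrow> A \<subseteq> topspace X"
  by (auto simp: clopenin_def openin_subset)

lemma clopenin_Union: "finite \<C> \<Longrightarrow> (\<And>C. C \<in> \<C> \<Longrightarrow> clopenin X C) \<Longrightarrow> clopenin X (\<Union>\<C>)"
  unfolding clopenin_def by (meson closedin_Union openin_Union)

lemma clopenin_compactin: "compact_space X \<Longrightarrow> clopenin X A \<Longrightarrow> compactin X A"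
  by (simp add: clopenin_def closedin_compact_space)

lemma zero_dimensionalD:
  assumes "zero_dimensional X" "openin X U" "z \<in> U"
  obtains C where "clopenin X C" "z \<in> C" "C \<subseteq> U"
  using assms unfolding zero_dimensional_def is_base_def by (metis Union_iff Union_upper subset_eq)

lemma zero_dimensionalI:
  assumes "\<And>U z. openin X U \<Longrightarrow> z \<in> U \<Longrightarrow> \<exists>C. clopenin X C \<and> z \<in> C \<and> C \<subseteq> U"
  shows "is_base X (Collect (clopenin X))" "zero_dimensional X"
proof -
  show "is_base X (Collect (clopenin X))"
    unfolding is_base_def
  proof (intro conjI allI impI)
    fix U assume "openin X U"
    then have "\<Union>{C. clopenin X C \<and> C \<subseteq> U} = U"
      using assms by blast
    then show "\<exists>\<C>\<subseteq>Collect (clopenin X). \<Union>\<C> = U"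
      by (intro exI[of _ "{C. clopenin X C \<and> C \<subseteq> U}"]) auto
  qed (auto simp: clopenin_def)
  then show "zero_dimensional X"
    unfolding zero_dimensional_def by blast
qed

text \<open>Clopen subsets of \<open>U\<close> cover the compact set \<open>F\<close>, and a finite
  subcover has a clopen union.\<close>

lemma compact_clopen_between:
  assumes "compact_space X" "zero_dimensional X" "closedin X F" "openin X U" "F \<subseteq> U"
  obtains D where "clopenin X D" "F \<subseteq> D" "D \<subseteq> U"
proof -
  have "compactin X F"
    using assms closedin_compact_space by blast
  moreover have "F \<subseteq> \<Union>{C. clopenin X C \<and> C \<subseteq> U}"
    using assms by (force elim!: zero_dimensionalD)
  ultimately obtain \<F> where "finite \<F>" "\<F> \<subseteq> {C. clopenin X C \<and> C \<subseteq> U}" "F \<subseteq> \<Union>\<F>"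
    unfolding compactin_def by (smt (verit) clopenin_def mem_Collect_eq)
  then show thesis
    by (intro that[of "\<Union>\<F>"] clopenin_Union) auto
qed

section \<open>Sets of type less than \<open>|K|\<close>\<close>

lemma card_image_less: "|A| <o |K| \<Longrightarrow> |f ` A| <o |K|"
  using card_of_image ordLeq_ordLess_trans by blast

lemma card_subset_less: "|B| <o |K| \<Longrightarrow> A \<subseteq> B \<Longrightarrow> |A| <o |K|"
  using card_of_mono1 ordLeq_ordLess_trans by blast

lemma card_finite_less: "infinite K \<Longrightarrow> finite A \<Longrightarrow> |A| <o |K|"
  by (meson card_of_Well_order card_of_ordLeq_finite not_ordLeq_iff_ordLess)

lemma type_lessI:
  assumes "|I| <o |K|" "\<And>i. i \<in> I \<Longrightarrow> clopenin X (C i)" "(\<Union>i\<in>I. C i) = U"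
  shows "type_less X U K"
  unfolding type_less_def using assms by (intro exI[of _ "C ` I"]) (auto simp: card_image_less)

lemma type_less_openin: "type_less X U K \<Longrightarrow> openin X U"
  unfolding type_less_def by (auto simp: clopenin_def)

lemma type_less_Un:
  assumes "infinite K" "type_less X U K" "type_less X V K"
  shows "type_less X (U \<union> V) K"
proof -
  obtain \<C> \<D> where "\<forall>C\<in>\<C>. clopenin X C" "\<Union>\<C> = U" "|\<C>| <o |K|"
    "\<forall>C\<in>\<D>. clopenin X C" "\<Union>\<D> = V" "|\<D>| <o |K|"
    using assms unfolding type_less_def by blast
  then show ?thesis
    unfolding type_less_def using assms(1) by (intro exI[of _ "\<C> \<union> \<D>"]) (auto simp: card_of_Un_ordLess_infinite)
qed

text \<open>The indicator function of one of the two sets is continuous on their union; any continuous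
  extension of it keeps their closures apart.\<close>
lemma F_kappa_clopen_separation:
  assumes X: "compact_space X" "F_kappa_space K X" and K: "infinite K"
    and U: "type_less X U K" and V: "type_less X V K" and UV: "U \<inter> V = {}"
  obtains D where "clopenin X D" "U \<subseteq> D" "D \<inter> V = {}"
proof -
  note open_UV = type_less_openin[OF U] type_less_openin[OF V]
  define f where "f z = (if z \<in> U then 0 else 1::real)" for z
  have "continuous_map (subtopology X (U \<union> V)) euclideanreal f"
    unfolding continuous_map_def
  proof (intro conjI allI impI)
    fix T :: "real set" assume "openin euclidean T"
    have "{z \<in> topspace (subtopology X (U \<union> V)). f z \<in> T} =
        (if 0 \<in> T then U else {}) \<union> (if 1 \<in> T then V else {})"
      using UV open_UV[THEN openin_subset] by (auto simp: f_def)
    then show "openin (subtopology X (U \<union> V)) {z \<in> topspace (subtopology X (U \<union> V)). f z \<in> T}"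
      using open_UV by (auto simp: openin_open_subtopology openin_Un)
  qed auto
  moreover have "bounded (f ` (topspace X \<inter> (U \<union> V)))"
    by (rule bounded_subset[of "{0,1}"]) (auto simp: f_def)
  moreover have "C_star_embedded X (U \<union> V)"
    using X(2) type_less_Un[OF K U V] type_less_openin unfolding F_kappa_space_def by blast
  ultimately obtain g where g: "continuous_map X euclideanreal g"
    "\<forall>z\<in>topspace X \<inter> (U \<union> V). g z = f z"
    unfolding C_star_embedded_def by blast
  have "closedin X {z \<in> topspace X. g z \<in> {..0}}" "openin X {z \<in> topspace X. g z \<in> {..<1}}"
    by (intro closedin_continuous_map_preimage[OF g(1)] openin_continuous_map_preimage[OF g(1)]; simp)+
  then obtain D where D: "clopenin X D" "{z \<in> topspace X. g z \<in> {..0}} \<subseteq> D"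
      "D \<subseteq> {z \<in> topspace X. g z \<in> {..<1}}"
    using compact_clopen_between[OF X(1)] X(2) unfolding F_kappa_space_def by force
  show thesis
  proof (rule that[OF D(1)])
    show "U \<subseteq> D"
      using D(2) g(2) open_UV[THEN openin_subset] by (force simp: f_def)
    show "D \<inter> V = {}"
    proof -
      have "g z = 1" if "z \<in> V" for z
      proof -
        have "z \<notin> U" "z \<in> topspace X"
          using that UV open_UV[THEN openin_subset] by auto
        then show ?thesis
          using that g(2) by (simp add: f_def)
      qed
      then show ?thesis
        using D(3) by force
    qed
  qed
qed

subsection \<open>Clopen separation along a cover\<close>

lemma card_order_strict_wf: "wf ( |K| - Id)"
  using card_of_Well_order[of K] unfolding well_order_on_def by simp

lemma card_order_strict_field: "(b, a) \<in> |K| - Id \<Longrightarrow> a \<in> K \<and> b \<in> K"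
  using Field_card_of[of K] by (auto simp: Field_def)

lemma card_order_total:
  "a \<in> K \<Longrightarrow> b \<in> K \<Longrightarrow> a = b \<or> (a, b) \<in> |K| - Id \<or> (b, a) \<in> |K| - Id"
  using card_of_Well_order[of K] unfolding well_order_on_def linear_order_on_def total_on_def
  by (auto simp: Field_card_of)

text \<open>The cardinal well-order has small initial segments: at each stage of a recursion along
  \<open>K\<close> fewer than \<open>|K|\<close> choices precede, so the smallness hypotheses of
  \<open>F_kappa_clopen_separation\<close> and of the \<open>G_kappa\<close> property are
  met.\<close>

lemma card_initial_segment_less: "a \<in> K \<Longrightarrow> |{b. (b, a) \<in> |K| - Id}| <o |K|"
  using card_of_underS[OF card_of_Card_order, of a K]
  by (auto simp: underS_def conj_commute Field_card_of)

text \<open>The set is glued from clopen pieces \<open>f a \<subseteq> C a\<close>. Coherence,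
  \<open>f a \<inter> C b = f b \<inter> C a\<close>, makes its complement in the cover equal to the
  union of the sets \<open>C a - f a\<close>, so both are open.\<close>

lemma clopen_separation_along_cover:
  assumes X: "compact_space X" "F_kappa_space K X" and K: "infinite K"
    and C: "\<And>a. a \<in> K \<Longrightarrow> clopenin X (C a)" and AB: "A \<inter> B = {}"
    and A: "\<And>a. a \<in> K \<Longrightarrow> type_less X (A \<inter> C a) K"
    and B: "\<And>a. a \<in> K \<Longrightarrow> type_less X (B \<inter> C a) K"
  obtains D where "D \<subseteq> (\<Union>a\<in>K. C a)" "openin X D" "openin X ((\<Union>a\<in>K. C a) - D)"
    "A \<inter> (\<Union>a\<in>K. C a) \<subseteq> D" "D \<inter> B = {}"
proof -
  let ?R = "|K| - Id"
  \<comment> \<open>\<open>P\<close> is vacuous off \<open>K\<close>, since the recursion yields a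
    total function on the index type.\<close>
  define P where "P f a d \<longleftrightarrow> (a \<in> K \<longrightarrow> clopenin X d \<and> d \<subseteq> C a \<and> A \<inter> C a \<subseteq> d \<and> d \<inter> B = {} \<and>
    (\<forall>b. (b, a) \<in> ?R \<longrightarrow> d \<inter> C b = f b \<inter> C a))" for f a d
  have "\<exists>f. \<forall>a. P f a (f a)"
  proof (rule dependent_wf_choice[OF card_order_strict_wf])
    show "P f a d = P g a d" if "\<And>b. (b, a) \<in> ?R \<Longrightarrow> f b = g b" for f g a d
      using that unfolding P_def by auto
  next
    fix a f assume IH: "\<And>b. (b, a) \<in> ?R \<Longrightarrow> P f b (f b)"
    show "\<exists>d. P f a d"
    proof (cases "a \<in> K")
      case True
      let ?I = "{b. (b, a) \<in> ?R}"
      have IK: "b \<in> K" if "b \<in> ?I" for b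
        using that card_order_strict_field by fastforce
      have f: "clopenin X (f b)" "f b \<subseteq> C b" "A \<inter> C b \<subseteq> f b" "f b \<inter> B = {}" if "b \<in> ?I" for b
        using IH[of b] IK[of b] that unfolding P_def by auto
      have coherent: "f b \<inter> C c = f c \<inter> C b" if "b \<in> ?I" "c \<in> ?I" for b c
        using card_order_total[OF IK IK, OF that] IH[of b] IH[of c] IK that unfolding P_def by auto
      \<comment> \<open>\<open>E\<close> must lie inside the new piece, and \<open>E'\<close> meets
        \<open>C a\<close> only outside it. Coherence of the earlier pieces makes the two disjoint;
        as there are fewer than \<open>|K|\<close> earlier pieces, both types are small.\<close>
      define E E' where "E = (\<Union>b\<in>?I. f b) \<union> (A \<inter> C a)"
        and "E' = (\<Union>b\<in>?I. C b - f b) \<union> (B \<inter> C a)"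
      have "type_less X (\<Union>b\<in>?I. f b) K"
        by (rule type_lessI[where I = ?I and C = f]) (use f True card_initial_segment_less in auto)
      moreover have "type_less X (\<Union>b\<in>?I. C b - f b) K"
        by (rule type_lessI[where I = ?I and C = "\<lambda>b. C b - f b"])
          (use card_initial_segment_less[OF True] clopenin_Diff[OF C f(1)] IK in auto)
      ultimately have "type_less X E K" "type_less X E' K"
        unfolding E_def E'_def using K A B True type_less_Un by blast+
      moreover have "E \<inter> E' = {}"
      proof -
        have "f b \<inter> (C c - f c) = {}" if "b \<in> ?I" "c \<in> ?I" for b c
          using coherent[OF that] f(2)[OF that(1)] by blast
        moreover have "A \<inter> (C c - f c) = {}" "f c \<inter> B = {}" if "c \<in> ?I" for c
          using f[OF that] by auto
        ultimately show ?thesis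
          unfolding E_def E'_def using AB by blast
      qed
      ultimately obtain D where D: "clopenin X D" "E \<subseteq> D" "D \<inter> E' = {}"
        using F_kappa_clopen_separation[OF X K] by blast
      have "(D \<inter> C a) \<inter> C b = f b \<inter> C a" if "b \<in> ?I" for b
      proof -
        have "f b \<subseteq> D" "D \<inter> (C b - f b) = {}"
          using D that unfolding E_def E'_def by blast+
        then show ?thesis
          using f(2)[OF that] by blast
      qed
      moreover have "A \<inter> C a \<subseteq> D" "D \<inter> C a \<inter> B = {}"
        using D unfolding E_def E'_def by blast+
      ultimately have "P f a (D \<inter> C a)"
        unfolding P_def using D(1) C[OF True] clopenin_Int by blast
      then show ?thesis ..
    qed (auto simp: P_def)
  qed
  then obtain f where f: "\<And>a. P f a (f a)"
    by blast
  have f1: "clopenin X (f a)" "f a \<subseteq> C a" "A \<inter> C a \<subseteq> f a" "f a \<inter> B = {}" if "a \<in> K" for a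
    using f[of a] that unfolding P_def by auto
  have f2: "f a \<inter> C b = f b \<inter> C a" if "a \<in> K" "b \<in> K" for a b
    using card_order_total[OF that] f[of a] f[of b] that unfolding P_def by auto
  define D where "D = (\<Union>a\<in>K. f a)"
  have "(\<Union>a\<in>K. C a) - D = (\<Union>a\<in>K. C a - f a)"
  proof -
    have "f b \<inter> C a \<subseteq> f a" if "a \<in> K" "b \<in> K" for a b
      using f2[OF that] by auto
    then show ?thesis
      unfolding D_def using f1(2) by blast
  qed
  moreover have "openin X (C a - f a)" "openin X (f a)" if "a \<in> K" for a
    using clopenin_Diff C f1 that unfolding clopenin_def by auto
  ultimately have "openin X D" "openin X ((\<Union>a\<in>K. C a) - D)"
    unfolding D_def by auto
  moreover have "D \<subseteq> (\<Union>a\<in>K. C a)" "A \<inter> (\<Union>a\<in>K. C a) \<subseteq> D" "D \<inter> B = {}"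
    unfolding D_def using f1(2-4) by blast+
  ultimately show thesis
    using that by blast
qed

subsection \<open>Level cuts of continuous functions\<close>

text \<open>For uncountable \<open>K\<close> these are the countable unions of clopen sets, for
  countably infinite \<open>K\<close> the finite ones. With both bounds, cardinal arithmetic alone
  keeps the union of fewer than \<open>|K|\<close> such sets of small type.\<close>

definition sigma_clopen :: "'k set \<Rightarrow> 'a topology \<Rightarrow> 'a set \<Rightarrow> bool" where
  "sigma_clopen K X S \<longleftrightarrow> (\<exists>\<D>. countable \<D> \<and> |\<D>| <o |K| \<and>
     (\<forall>D\<in>\<D>. clopenin X D) \<and> \<Union>\<D> = S)"

lemma sigma_clopen_type_less: "sigma_clopen K X S \<Longrightarrow> type_less X S K"
  unfolding sigma_clopen_def type_less_def by blast

lemma clopen_sigma_clopen: "infinite K \<Longrightarrow> clopenin X C \<Longrightarrow> sigma_clopen K X C"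
  unfolding sigma_clopen_def by (intro exI[of _ "{C}"]) (auto simp: card_finite_less)

lemma countable_card_less: "countable A \<Longrightarrow> uncountable K \<Longrightarrow> |A| <o |K|"
  by (metis card_of_Well_order countable_card_of_nat not_ordLess_iff_ordLeq ordLeq_transitive)

lemma card_less_countable_finite: "countable K \<Longrightarrow> |A| <o |K| \<Longrightarrow> finite A"
  by (metis countable_card_of_nat infinite_iff_card_of_nat not_ordLess_ordLeq ordLeq_transitive)

text \<open>For countable \<open>K\<close> the index set and all families are finite. For
  uncountable \<open>K\<close> a finite \<open>I\<close> gives a countable family and an infinite
  \<open>I\<close> one of size at most \<open>|I|\<close>.\<close>

lemma type_less_UN_sigma_clopen:
  assumes K: "infinite K" and I: "|I| <o |K|" and S: "\<And>i. i \<in> I \<Longrightarrow> sigma_clopen K X (S i)"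
  shows "type_less X (\<Union>i\<in>I. S i) K"
proof -
  obtain \<D> where \<D>: "\<And>i. i \<in> I \<Longrightarrow> countable (\<D> i) \<and> |\<D> i| <o |K| \<and>
      (\<forall>D\<in>\<D> i. clopenin X D) \<and> \<Union>(\<D> i) = S i"
    using S unfolding sigma_clopen_def by metis
  have "|\<Union>i\<in>I. \<D> i| <o |K|"
  proof (cases "countable K")
    case True
    then have "finite (\<Union>i\<in>I. \<D> i)"
      using \<D> I by (auto intro: card_less_countable_finite)
    then show ?thesis
      using K card_finite_less by blast
  next
    case False
    show ?thesis
    proof (cases "finite I")
      case True
      then show ?thesis
        using \<D> False by (intro countable_card_less) (auto intro: countable_finite)
    next
      case infI: False
      have "|\<Union>i\<in>I. \<D> i| \<le>o |I|"
        using \<D> infI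
        by (intro card_of_UNION_ordLeq_infinite)
          (meson card_of_UNION_ordLeq_infinite countable_card_of_nat infinite_iff_card_of_nat
            ordLeq_transitive card_of_mono1 order_refl)+
      then show ?thesis
        using I ordLeq_ordLess_trans by blast
    qed
  qed
  moreover have "(\<Union>D\<in>(\<Union>i\<in>I. \<D> i). D) = (\<Union>i\<in>I. S i)"
  proof -
    have "S i = \<Union>(\<D> i)" if "i \<in> I" for i
      using \<D> that by blast
    then show ?thesis
      by auto
  qed
  ultimately show ?thesis
    using \<D> by (intro type_lessI[of "\<Union>i\<in>I. \<D> i" K X "\<lambda>D. D"]) auto
qed

text \<open>Continuity of \<open>f\<close> is known on \<open>U\<close> only, but \<open>C\<close>
  is closed in \<open>X\<close>: the complement of a closed preimage is the part outside
  \<open>C\<close> together with an open preimage.\<close>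

lemma preimage_on_clopen:
  fixes f :: "'a \<Rightarrow> real"
  assumes f: "continuous_map (subtopology X U) euclideanreal f" and U: "openin X U"
    and C: "clopenin X C" "C \<subseteq> U"
  shows "open T \<Longrightarrow> openin X {z \<in> C. f z \<in> T}" "closed T \<Longrightarrow> closedin X {z \<in> C. f z \<in> T}"
proof -
  have op: "openin X {z \<in> C. f z \<in> T}" if "open T" for T
  proof -
    have "openin (subtopology X U) {z \<in> topspace (subtopology X U). f z \<in> T}"
      using that by (intro openin_continuous_map_preimage[OF f]) simp
    then have "openin X (C \<inter> {z \<in> topspace (subtopology X U). f z \<in> T})"
      using C U unfolding clopenin_def by (simp add: openin_Int openin_open_subtopology)
    moreover have "C \<inter> {z \<in> topspace (subtopology X U). f z \<in> T} = {z \<in> C. f z \<in> T}"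
      using C clopenin_subset by auto
    ultimately show ?thesis
      by simp
  qed
  then show "open T \<Longrightarrow> openin X {z \<in> C. f z \<in> T}" .
  assume "closed T"
  then have "openin X ((topspace X - C) \<union> {z \<in> C. f z \<in> -T})"
    using op[of "-T"] C unfolding clopenin_def by (auto simp: openin_Un)
  moreover have "(topspace X - C) \<union> {z \<in> C. f z \<in> -T} = topspace X - {z \<in> C. f z \<in> T}"
    using C clopenin_subset by auto
  ultimately show "closedin X {z \<in> C. f z \<in> T}"
    using clopenin_subset[OF C(1)] unfolding closedin_def by auto
qed

text \<open>The set is the union of the compact subsets of \<open>C\<close> where \<open>f\<close>
  is at most \<open>m - 1/(n+1)\<close>, and a clopen set \<open>D n\<close> fits between each of
  these and the whole.\<close>

lemma sigma_clopen_cozero: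
  fixes f :: "'a \<Rightarrow> real"
  assumes X: "compact_space X" "zero_dimensional X" and K: "uncountable K"
    and f: "continuous_map (subtopology X U) euclideanreal f" and U: "openin X U"
    and C: "clopenin X C" "C \<subseteq> U"
  shows "sigma_clopen K X {z \<in> C. f z < m}"
proof -
  note pre = preimage_on_clopen[OF f U C]
  have "\<exists>D. clopenin X D \<and> {z \<in> C. f z \<in> {..m - inverse (real (Suc n))}} \<subseteq> D \<and>
      D \<subseteq> {z \<in> C. f z \<in> {..<m}}" for n
  proof -
    have "m - inverse (real (Suc n)) < m"
      by simp
    then have "{z \<in> C. f z \<in> {..m - inverse (real (Suc n))}} \<subseteq> {z \<in> C. f z \<in> {..<m}}"
      using order.strict_trans1 by blast
    then show ?thesis
      by (rule compact_clopen_between[OF X pre(2)[OF closed_atMost] pre(1)[OF open_lessThan]]) blast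
  qed
  from choice[OF allI[OF this]] obtain D where
    "\<forall>n. clopenin X (D n) \<and> {z \<in> C. f z \<in> {..m - inverse (real (Suc n))}} \<subseteq> D n \<and>
      D n \<subseteq> {z \<in> C. f z \<in> {..<m}}" ..
  note D = spec[OF this]
  have "z \<in> (\<Union>n. D n)" if "z \<in> C" "f z < m" for z
  proof -
    have "0 < m - f z"
      using that by simp
    then obtain n where n: "inverse (real (Suc n)) < m - f z"
      using reals_Archimedean by blast
    have "z \<in> {z \<in> C. f z \<in> {..m - inverse (real (Suc n))}}"
      using n that by simp
    then show ?thesis
      using D[of n] by blast
  qed
  then have "\<Union>(range D) = {z \<in> C. f z < m}"
    using D by blast
  moreover have "|range D| <o |K|"
    using K by (simp add: countable_card_less)
  ultimately show ?thesis
    unfolding sigma_clopen_def using D by (intro exI[of _ "range D"]) auto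
qed

text \<open>For uncountable \<open>K\<close>, take the sets where \<open>f\<close> lies below and above an intermediate level. For
  countable \<open>K\<close> these are in general not small on clopen sets; there \<open>U\<close> is the union of a disjoint
  sequence of clopen sets, and each of them is cut separately by compactness.\<close>
lemma level_cut:
  fixes f :: "'a \<Rightarrow> real"
  assumes X: "compact_space X" "zero_dimensional X" and K: "infinite K"
    and \<C>: "\<And>C. C \<in> \<C> \<Longrightarrow> clopenin X C" "|\<C>| \<le>o |K|" and U: "U = \<Union>\<C>"
    and f: "continuous_map (subtopology X U) euclideanreal f" and pq: "p < q"
  obtains A B where "A \<inter> B = {}" "A \<subseteq> U" "B \<subseteq> U"
    "{z \<in> U. f z \<le> p} \<subseteq> A" "{z \<in> U. q \<le> f z} \<subseteq> B"
    "\<And>C. clopenin X C \<Longrightarrow> C \<subseteq> U \<Longrightarrow> sigma_clopen K X (A \<inter> C)"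
    "\<And>C. clopenin X C \<Longrightarrow> C \<subseteq> U \<Longrightarrow> sigma_clopen K X (B \<inter> C)"
proof -
  have opU: "openin X U"
    using \<C> U unfolding clopenin_def by blast
  show thesis
  proof (cases "countable K")
    case False
    define m where "m = (p + q) / 2"
    have f': "continuous_map (subtopology X U) euclideanreal (\<lambda>z. - f z)"
      using f by (intro continuous_intros)
    show thesis
    proof (rule that[of "{z \<in> U. f z < m}" "{z \<in> U. - f z < - m}"])
      fix C assume C: "clopenin X C" "C \<subseteq> U"
      have "{z \<in> U. f z < m} \<inter> C = {z \<in> C. f z < m}"
        "{z \<in> U. - f z < - m} \<inter> C = {z \<in> C. - f z < - m}"
        using C by auto
      then show "sigma_clopen K X ({z \<in> U. f z < m} \<inter> C)"
        "sigma_clopen K X ({z \<in> U. - f z < - m} \<inter> C)"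
        using sigma_clopen_cozero[OF X False f opU C, of m]
          sigma_clopen_cozero[OF X False f' opU C, of "-m"] by (simp_all only:)
    qed (use pq in \<open>auto simp: m_def\<close>)
  next
    case True
    show thesis
    proof (cases "\<C> = {}")
      case True
      then show thesis
        using U clopen_sigma_clopen[OF K clopenin_empty] by (intro that[of "{}" "{}"]) auto
    next
      case False
      have "countable \<C>"
        using \<C>(2) True countable_card_of_nat ordLeq_transitive by metis
      \<comment> \<open>If \<open>\<C>\<close> is finite, the enumeration repeats members;
        \<open>disjointed\<close> turns the repetitions into empty sets.\<close>
      define c where "c = disjointed (from_nat_into \<C>)"
      have Uc: "(\<Union>n. c n) = U"
        using UN_from_nat_into[OF \<open>countable \<C>\<close> False, of "\<lambda>x. x"]
        unfolding c_def U UN_disjointed_eq by simp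
      have c: "clopenin X (c n)" for n
      proof -
        have "clopenin X (from_nat_into \<C> k)" for k
          by (rule \<C>(1)[OF from_nat_into[OF False]])
        then show ?thesis
          unfolding c_def disjointed_def by (intro clopenin_Diff clopenin_Union) auto
      qed
      have disj: "c m \<inter> c n = {}" if "m \<noteq> n" for m n
        using disjoint_family_onD[OF disjoint_family_disjointed UNIV_I UNIV_I that]
        unfolding c_def .
      have "\<exists>D. clopenin X D \<and> {z \<in> c n. f z \<in> {..p}} \<subseteq> D \<and> D \<subseteq> {z \<in> c n. f z \<in> {..<q}}" for n
      proof -
        have "c n \<subseteq> U" "{z \<in> c n. f z \<in> {..p}} \<subseteq> {z \<in> c n. f z \<in> {..<q}}"
          using pq by (auto simp flip: Uc)
        then show ?thesis
          by - (rule compact_clopen_between[OF X preimage_on_clopen(2)[OF f opU c _ closed_atMost]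
              preimage_on_clopen(1)[OF f opU c _ open_lessThan]]; blast)
      qed
      from choice[OF allI[OF this]] obtain D where
        "\<forall>n. clopenin X (D n) \<and> {z \<in> c n. f z \<in> {..p}} \<subseteq> D n \<and> D n \<subseteq> {z \<in> c n. f z \<in> {..<q}}" ..
      note D = spec[OF this, THEN conjunct1] spec[OF this, THEN conjunct2, THEN conjunct1]
        spec[OF this, THEN conjunct2, THEN conjunct2]
      define A B where "A = (\<Union>n. D n)" and "B = (\<Union>n. c n - D n)"
      have AB: "A \<inter> B = {}"
      proof -
        have "D m \<inter> (c n - D n) = {}" for m n
          using disj[of m n] D(3)[of m] by (cases "m = n") auto
        then show ?thesis
          unfolding A_def B_def by blast
      qed
      have ABU: "A \<union> B = U"
        unfolding A_def B_def Uc[symmetric] using D(3) by blast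
      have op: "openin X A" "openin X B"
        unfolding A_def B_def using D(1) c by (auto simp: clopenin_def)
      \<comment> \<open>The open sets \<open>A\<close> and \<open>B\<close> partition
        \<open>U\<close>, so each trace on a clopen \<open>C\<close> has an open complement in
        \<open>C\<close>.\<close>
      have clo: "clopenin X (A \<inter> C)" "clopenin X (B \<inter> C)" if "clopenin X C" "C \<subseteq> U" for C
      proof -
        have "A \<inter> C = C - B \<inter> C" "B \<inter> C = C - A \<inter> C"
          using ABU AB that by auto
        then show "clopenin X (A \<inter> C)" "clopenin X (B \<inter> C)"
          using that op unfolding clopenin_def by (metis closedin_diff openin_Int)+
      qed
      show thesis
      proof (rule that[OF AB])
        show "{z \<in> U. f z \<le> p} \<subseteq> A" "{z \<in> U. q \<le> f z} \<subseteq> B"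
        proof -
          show "{z \<in> U. f z \<le> p} \<subseteq> A"
            using D(2) unfolding A_def Uc[symmetric] by blast
          have "z \<notin> D n" if "q \<le> f z" for z n
            using D(3)[of n] that by auto
          then show "{z \<in> U. q \<le> f z} \<subseteq> B"
            unfolding B_def Uc[symmetric] by blast
        qed
        show "sigma_clopen K X (A \<inter> C)" "sigma_clopen K X (B \<inter> C)" if "clopenin X C" "C \<subseteq> U" for C
          using that clo clopen_sigma_clopen[OF K] by blast+
      qed (use ABU in auto)
    qed
  qed
qed

section \<open>Extending bounded functions from an open set\<close>

text \<open>On the closure \<open>T\<close> of \<open>U\<close> the extension at \<open>z\<close> is
  the infimum of the levels \<open>q\<close> for which \<open>z\<close> is in the closure of the set
  where \<open>f < q\<close>. Clopen separation of level sets makes it continuous, and Tietze's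
  theorem extends it from \<open>T\<close> to \<open>Z\<close>.\<close>

lemma C_star_embedded_clopen_separation:
  assumes Z: "normal_space Z" and U: "openin Z U"
    and sep: "\<And>f p q. continuous_map (subtopology Z U) euclideanreal f \<Longrightarrow> p < q \<Longrightarrow>
      \<exists>D. clopenin Z D \<and> {z \<in> U. f z \<le> p} \<subseteq> D \<and> D \<inter> {z \<in> U. q \<le> f z} = {}"
  shows "C_star_embedded Z U"
  unfolding C_star_embedded_def
proof (intro allI impI, elim conjE)
  fix f :: "'a \<Rightarrow> real"
  assume f: "continuous_map (subtopology Z U) euclideanreal f"
    and bdd: "bounded (f ` (topspace Z \<inter> U))"
  have UZ: "U \<subseteq> topspace Z"
    using U openin_subset by blast
  then have "bounded (f ` U)"
    using bdd by (simp add: Int_absorb1)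
  then obtain c where c: "\<And>u. u \<in> U \<Longrightarrow> \<bar>f u\<bar> \<le> c"
    unfolding bounded_real by auto
  define T where "T = Z closure_of U"
  define L where "L q = Z closure_of {u \<in> U. f u < q}" for q
  define g where "g z = Inf {q. z \<in> L q}" for z
  have UT: "U \<subseteq> T"
    unfolding T_def by (rule closure_of_subset[OF UZ])
  \<comment> \<open>Boundedness of \<open>f\<close> ensures that, at points of \<open>T\<close>, the
    infimum in \<open>g\<close> is over a nonempty set bounded below.\<close>
  have bddL: "bdd_below {q. z \<in> L q}" for z
  proof (rule bdd_belowI[of _ "-c"])
    fix q assume "q \<in> {q. z \<in> L q}"
    then have "{u \<in> U. f u < q} \<noteq> {}"
      unfolding L_def using closure_of_empty by fastforce
    then show "- c \<le> q"
      using c by fastforce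
  qed
  have neL: "{q. z \<in> L q} \<noteq> {}" if "z \<in> T" for z
  proof -
    have "f u < c + 1" if "u \<in> U" for u
      using c[OF that] by linarith
    then have "{u \<in> U. f u < c + 1} = U"
      by auto
    then have "z \<in> L (c + 1)"
      using that unfolding L_def T_def by simp
    then show ?thesis
      by blast
  qed
  have gle: "g z \<le> q" if "z \<in> L q" for z q
    unfolding g_def by (rule cInf_lower) (use that bddL in auto)
  have gge: "p \<le> g z" if "z \<in> T" "\<And>r. z \<in> L r \<Longrightarrow> p \<le> r" for z p
    unfolding g_def by (rule cInf_greatest) (use that neL in auto)
  \<comment> \<open>\<open>DT\<close> and \<open>LD\<close> are the continuity estimates: a clopen
    \<open>D\<close> separating \<open>f \<le> p\<close> from \<open>q \<le> f\<close> gives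
    \<open>g \<le> q\<close> on \<open>T \<inter> D\<close> and \<open>p \<le> g\<close> on
    \<open>T - D\<close>.\<close>
  have DT: "z \<in> L q" if "clopenin Z D" "D \<inter> {u \<in> U. q \<le> f u} = {}" "z \<in> D" "z \<in> T" for D q z
  proof -
    have "z \<in> Z closure_of (D \<inter> U)"
      using that openin_Int_closure_of_subset[of Z D U] unfolding clopenin_def T_def by blast
    moreover have "D \<inter> U \<subseteq> {u \<in> U. f u < q}"
      using that(2) by (auto simp: not_le)
    ultimately show ?thesis
      unfolding L_def using closure_of_mono by blast
  qed
  have LD: "L q \<subseteq> D" if "clopenin Z D" "{u \<in> U. f u \<le> p} \<subseteq> D" "q \<le> p" for D p q
    unfolding L_def by (rule closure_of_minimal) (use that in \<open>auto simp: clopenin_def\<close>)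
  have T_open: "openin (subtopology Z T) (T \<inter> D)" if "clopenin Z D" for D
    using that unfolding clopenin_def by (simp add: openin_subtopology_Int2)
  have topT: "topspace (subtopology Z T) = T"
    unfolding T_def by (simp add: closure_of_subset_topspace Int_absorb1)
  have cont: "continuous_map (subtopology Z T) euclideanreal g"
    unfolding continuous_map_upper_lower_semicontinuous_lt topT
  proof (intro allI conjI)
    fix a
    show "openin (subtopology Z T) {z \<in> T. a < g z}"
    proof (subst openin_subopen, intro ballI)
      fix z assume "z \<in> {z \<in> T. a < g z}"
      then have z: "z \<in> T" "a < g z" by auto
      then obtain p where p: "a < p" "p < g z"
        using dense by blast
      then obtain q where q: "p < q" "q < g z"
        using dense by blast
      obtain D where D: "clopenin Z D" "{z \<in> U. f z \<le> p} \<subseteq> D" "D \<inter> {z \<in> U. q \<le> f z} = {}"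
        using sep[OF f q(1)] by blast
      have "z \<notin> D"
        using DT[OF D(1,3) _ z(1)] gle q(2) by fastforce
      moreover have "a < g w" if "w \<in> T - D" for w
      proof -
        have "p \<le> g w"
        proof (rule gge)
          fix r assume "w \<in> L r"
          then show "p \<le> r"
            using LD[OF D(1,2), of r] that by (cases "r \<le> p") auto
        qed (use that in auto)
        then show ?thesis using p by linarith
      qed
      moreover have "openin (subtopology Z T) (T \<inter> (topspace Z - D))"
        by (intro T_open clopenin_Diff D(1)) simp
      moreover have "T \<inter> (topspace Z - D) = T - D"
        using topT by auto
      ultimately show "\<exists>V. openin (subtopology Z T) V \<and> z \<in> V \<and> V \<subseteq> {z \<in> T. a < g z}"
        using z(1) by (intro exI[of _ "T - D"]) auto
    qed
    show "openin (subtopology Z T) {z \<in> T. g z < a}"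
    proof (subst openin_subopen, intro ballI)
      fix z assume "z \<in> {z \<in> T. g z < a}"
      then have z: "z \<in> T" "g z < a" by auto
      then obtain p where p: "z \<in> L p" "p < a"
        using cInf_less_iff[OF neL[OF z(1)] bddL, of a] unfolding g_def by auto
      then obtain q where q: "p < q" "q < a"
        using dense by blast
      obtain D where D: "clopenin Z D" "{z \<in> U. f z \<le> p} \<subseteq> D" "D \<inter> {z \<in> U. q \<le> f z} = {}"
        using sep[OF f q(1)] by blast
      have "g w < a" if "w \<in> T \<inter> D" for w
        using gle[OF DT[OF D(1,3)], of w] that q(2) by auto
      moreover have "z \<in> D"
        using LD[OF D(1,2) order_refl] p by auto
      ultimately show "\<exists>V. openin (subtopology Z T) V \<and> z \<in> V \<and> V \<subseteq> {z \<in> T. g z < a}"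
        using z(1) T_open[OF D(1)] by (intro exI[of _ "T \<inter> D"]) auto
    qed
  qed
  have gf: "g u = f u" if u: "u \<in> U" for u
  proof (rule antisym)
    show "g u \<le> f u"
    proof (rule field_le_epsilon)
      fix e :: real assume "e > 0"
      then have "u \<in> {v \<in> U. f v < f u + e}"
        using u by auto
      then have "u \<in> L (f u + e)"
        unfolding L_def using closure_of_subset[of "{v \<in> U. f v < f u + e}" Z] UZ by blast
      then show "g u \<le> f u + e"
        by (rule gle)
    qed
    show "f u \<le> g u"
    proof (rule gge)
      fix r assume r: "u \<in> L r"
      show "f u \<le> r"
      proof (rule ccontr)
        assume "\<not> f u \<le> r"
        define V where "V = {v \<in> topspace (subtopology Z U). f v \<in> {r<..}}"
        have "openin (subtopology Z U) V"
          unfolding V_def by (rule openin_continuous_map_preimage[OF f]) simp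
        then have "openin Z V"
          using U by (rule openin_trans_full)
        moreover have "u \<in> V"
          unfolding V_def using subsetD[OF UZ u] u \<open>\<not> f u \<le> r\<close> by simp
        moreover have "V \<inter> {v \<in> U. f v < r} = {}"
          unfolding V_def by auto
        ultimately show False
          using r openin_Int_closure_of_eq_empty[of Z V] unfolding L_def by blast
      qed
    qed (use u UT in auto)
  qed
  obtain h where "continuous_map Z euclideanreal h" "\<And>z. z \<in> T \<Longrightarrow> h z = g z"
  proof (rule Tietze_extension_realinterval[OF Z, of T UNIV g])
    show "closedin Z T"
      unfolding T_def by simp
  qed (use cont in auto)
  then show "\<exists>h. continuous_map Z euclideanreal h \<and> (\<forall>z\<in>topspace Z \<inter> U. h z = f z)"
    using gf UT by (intro exI[of _ h]) auto
qed

subsection \<open>Small families of open sets; bases\<close>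

text \<open>For \<open>Y_fip\<close>: the sets chosen at the last index of a finite subfamily lie in
  all its members.\<close>

lemma card_order_finite_max:
  assumes "finite F" "F \<noteq> {}" "F \<subseteq> K"
  shows "\<exists>m\<in>F. \<forall>b\<in>F. b = m \<or> (b, m) \<in> |K| - Id"
  using assms
proof (induction F rule: finite_ne_induct)
  case (insert a F)
  then obtain m where m: "m \<in> F" "\<forall>b\<in>F. b = m \<or> (b, m) \<in> |K| - Id"
    by auto
  have "trans |K|" "antisym |K|"
    using card_of_Well_order[of K]
    unfolding well_order_on_def linear_order_on_def partial_order_on_def preorder_on_def by auto
  then have trans: "(b, a) \<in> |K| - Id" if "(b, m) \<in> |K| - Id" "(m, a) \<in> |K| - Id" for b
    using that unfolding trans_def antisym_def by blast
  have amK: "a \<in> K" "m \<in> K"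
    using insert.prems m(1) by auto
  consider "a = m" | "(a, m) \<in> |K| - Id" | "(m, a) \<in> |K| - Id"
    using card_order_total[OF amK] by (elim disjE)
  then show ?case
  proof cases
    case 1
    then show ?thesis
      using m by (intro bexI[of _ m]) auto
  next
    case 2
    then show ?thesis
      using m by (intro bexI[of _ m]) auto
  next
    case 3
    then have "b = a \<or> (b, a) \<in> |K| - Id" if "b \<in> insert a F" for b
      using m(2) trans[OF _ 3] 3 that by (metis insertE)
    then show ?thesis
      by blast
  qed
qed auto

lemma nonempty_open_clopen_avoiding:
  assumes X: "zero_dimensional X" "Hausdorff_space X" "\<forall>z\<in>topspace X. \<not> openin X {z}"
    and U: "openin X U" "U \<noteq> {}"
  obtains V where "clopenin X V" "V \<noteq> {}" "V \<subseteq> U" "x \<notin> V"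
proof -
  have "U \<noteq> {x}"
    using X(3) U openin_subset by blast
  then obtain z where z: "z \<in> U - {x}"
    using U by blast
  have "openin X (U - {x})"
    using X(2) U(1) by (simp add: open_in_Hausdorff_delete)
  then obtain V where "clopenin X V" "z \<in> V" "V \<subseteq> U - {x}"
    using zero_dimensionalD[OF X(1) _ z] by blast
  then show thesis
    by (intro that[of V]) auto
qed

lemma clopen_split:
  assumes X: "zero_dimensional X" "Hausdorff_space X" "\<forall>z\<in>topspace X. \<not> openin X {z}"
    and V: "clopenin X V" "V \<noteq> {}"
  obtains v v' where "clopenin X v" "clopenin X v'" "v \<noteq> {}" "v' \<noteq> {}" "v \<inter> v' = {}" "v \<union> v' \<subseteq> V"
proof -
  obtain z where z: "z \<in> V"
    using V by blast
  have "openin X V"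
    using V by (simp add: clopenin_def)
  then obtain v where v: "clopenin X v" "v \<noteq> {}" "v \<subseteq> V" "z \<notin> v"
    using nonempty_open_clopen_avoiding[OF X _ V(2), of z] by blast
  show thesis
    by (rule that[OF v(1) clopenin_Diff[OF V(1) v(1)]]) (use v z in auto)
qed

text \<open>The form in which the \<open>G_kappa\<close> property is applied. The avoided point
  \<open>x\<close> may coincide with \<open>z\<close>, as in \<open>many_clopens\<close>.\<close>

lemma G_kappa_clopen_avoiding:
  assumes X: "kappa_Parovicenko K X" and z: "z \<in> topspace X"
    and \<A>: "\<And>A. A \<in> \<A> \<Longrightarrow> openin X A \<and> z \<in> A" "|\<A>| <o |K|"
  obtains V where "clopenin X V" "V \<noteq> {}" "x \<notin> V" "\<And>A. A \<in> \<A> \<Longrightarrow> V \<subseteq> A"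
proof -
  define U where "U = X interior_of (topspace X \<inter> \<Inter>\<A>)"
  have "U \<noteq> {}"
    using X z \<A> unfolding kappa_Parovicenko_def G_kappa_space_def U_def by blast
  moreover have "openin X U"
    unfolding U_def by simp
  ultimately obtain V where "clopenin X V" "V \<noteq> {}" "V \<subseteq> U" "x \<notin> V"
    using nonempty_open_clopen_avoiding X unfolding kappa_Parovicenko_def by metis
  moreover have "U \<subseteq> \<Inter>\<A>"
    unfolding U_def using interior_of_subset by fastforce
  ultimately show thesis
    by (intro that[of V]) auto
qed

section \<open>Counting open and clopen sets by a base\<close>

text \<open>Each set of size \<open>n + 1\<close> arises by inserting a point into one of size
  \<open>n\<close>, so every size class \<open>S n\<close> has at most \<open>|B|\<close> members,
  and there are countably many classes.\<close>

lemma card_Fpow_infinite: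
  assumes B: "infinite B"
  shows "|Fpow B| \<le>o |B|"
proof -
  define S where "S n = {F. F \<subseteq> B \<and> finite F \<and> card F = n}" for n
  have "|S n| \<le>o |B|" for n
  proof (induction n)
    case 0
    have "S 0 = {{}}"
      by (auto simp: S_def)
    then show ?case
      using B card_of_singl_ordLeq infinite_imp_nonempty by metis
  next
    case (Suc n)
    have "F \<in> (\<lambda>(b, F). insert b F) ` (B \<times> S n)" if F: "F \<in> S (Suc n)" for F
    proof -
      obtain b G where "F = insert b G" "b \<notin> G" "card G = n" "finite G"
        using F card_Suc_eq_finite[of F n] unfolding S_def by blast
      then show ?thesis
        using F unfolding S_def by (intro image_eqI[of _ _ "(b, G)"]) auto
    qed
    then have "|S (Suc n)| \<le>o |B \<times> S n|"
      by (intro surj_imp_ordLeq[of _ "\<lambda>(b, F). insert b F"]) blast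
    moreover have "|B \<times> S n| \<le>o |B|"
      by (rule card_of_Times_ordLeq_infinite_Field)
        (use B Suc.IH in \<open>auto simp: Field_card_of card_of_card_order_on card_of_mono1\<close>)
    ultimately show ?case
      using ordLeq_transitive by blast
  qed
  then have "|\<Union>n\<in>(UNIV::nat set). S n| \<le>o |B|"
    using B infinite_iff_card_of_nat by (intro card_of_UNION_ordLeq_infinite) auto
  moreover have "(\<Union>n\<in>(UNIV::nat set). S n) = Fpow B"
    by (auto simp: S_def Fpow_def)
  ultimately show ?thesis
    by simp
qed

lemma card_Pow_mono:
  assumes "|A| \<le>o |B|"
  shows "|Pow A| \<le>o |Pow B|"
proof -
  obtain f where f: "inj_on f A" "f ` A \<subseteq> B"
    using assms card_of_ordLeq by metis
  show ?thesis
    by (rule card_of_ordLeqI[of "(`) f"]) (use f inj_on_image_Pow in auto)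
qed

lemma card_open_sets_le:
  assumes "is_base X B"
  shows "|Collect (openin X)| \<le>o |Pow B|"
proof -
  have "U \<in> Union ` Pow B" if "openin X U" for U
    using assms that unfolding is_base_def by blast
  then show ?thesis
    by (intro surj_imp_ordLeq[of _ Union]) blast
qed

text \<open>By compactness a clopen set is a union of finitely many members of the base. For
  \<open>X\<close> this bounds the size of the cover of the punctured space, for \<open>Z\<close> it
  bounds the weight from below.\<close>

lemma card_clopens_le_base:
  assumes X: "compact_space X" and B: "is_base X B" "infinite B"
  shows "|Collect (clopenin X)| \<le>o |B|"
proof -
  have "A \<in> Union ` Fpow B" if A: "clopenin X A" for A
  proof -
    obtain \<C> where \<C>: "\<C> \<subseteq> B" "\<Union>\<C> = A"
      using A B(1) unfolding clopenin_def is_base_def by blast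
    then have "\<And>U. U \<in> \<C> \<Longrightarrow> openin X U"
      using B(1) unfolding is_base_def by blast
    then obtain \<F> where "finite \<F>" "\<F> \<subseteq> \<C>" "A \<subseteq> \<Union>\<F>"
      using clopenin_compactin[OF X A] \<C>(2) unfolding compactin_def by (metis order_refl)
    then have "A = \<Union>\<F>" "\<F> \<in> Fpow B"
      using \<C> unfolding Fpow_def by auto
    then show ?thesis
      by blast
  qed
  then have "|Collect (clopenin X)| \<le>o |Fpow B|"
    by (intro surj_imp_ordLeq[of _ Union]) blast
  then show ?thesis
    using card_Fpow_infinite[OF B(2)] ordLeq_transitive by blast
qed

lemma card_clopens_le:
  assumes X: "compact_space X" and B: "is_base X B" "|B| \<le>o |K|" and K: "infinite K"
  shows "|Collect (clopenin X)| \<le>o |K|"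
proof (cases "finite B")
  case True
  have "Collect (clopenin X) \<subseteq> Union ` Pow B"
    using B(1) unfolding is_base_def clopenin_def by blast
  then have "finite (Collect (clopenin X))"
    using True finite_subset by blast
  then show ?thesis
    using K card_finite_less ordLess_imp_ordLeq by blast
next
  case False
  then show ?thesis
    using card_clopens_le_base[OF X B(1)] B(2) ordLeq_transitive by blast
qed

text \<open>Rules out \<open>card K \<le> 1\<close>, the case left by
  \<open>lt_power_finite\<close>. With a single possible basic set all nonempty open sets coincide,
  against the separation of two points.\<close>

lemma base_not_singleton:
  assumes X: "Hausdorff_space X" "\<forall>z\<in>topspace X. \<not> openin X {z}" and x: "x \<in> topspace X"
    and B: "is_base X B"
  shows "\<not> B \<subseteq> {b}"
proof
  assume "B \<subseteq> {b}"
  have "topspace X \<noteq> {x}"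
    using X(2) x openin_topspace by metis
  then obtain y where y: "y \<in> topspace X" "y \<noteq> x"
    using x by blast
  then obtain U V where UV: "openin X U" "openin X V" "x \<in> U" "y \<in> V" "disjnt U V"
    using X(1)[unfolded Hausdorff_space_def, rule_format, of x y] x y by blast
  have "W = {} \<or> W = b" if W: "openin X W" for W
  proof -
    obtain \<C> where "\<C> \<subseteq> B" "\<Union>\<C> = W"
      using B W unfolding is_base_def by blast
    then show ?thesis
      using \<open>B \<subseteq> {b}\<close> by blast
  qed
  then have "U = V"
    using UV by blast
  then show False
    using UV unfolding disjnt_def by blast
qed

text \<open>A finite set with \<open>n \<ge> 2\<close> elements has \<open>n\<^sup>2 > n\<close> partial maps with a one-element domain.\<close>
lemma lt_power_finite:
  assumes K: "finite K" and pow: "|lt_power K| =o |K|"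
  shows "card K \<le> 1"
proof (rule ccontr)
  assume *: "\<not> card K \<le> 1"
  have "finite (lt_power K)"
    using pow K by (meson card_of_ordLeq_finite ordIso_imp_ordLeq)
  define s where "s = (\<lambda>(a, b). [a \<mapsto> b] :: 'a \<rightharpoonup> 'a)"
  have s: "dom (s z) = {fst z}" "ran (s z) = {snd z}" for z
    by (cases z; simp add: s_def)+
  then have inj: "inj_on s (K \<times> K)"
    by (intro inj_onI) (metis prod_eqI singleton_inject)
  have "|{a}| <o |K|" for a
  proof -
    have "\<not> |K| \<le>o |{a}|"
    proof
      assume "|K| \<le>o |{a}|"
      then obtain f where "inj_on f K" "f ` K \<subseteq> {a}"
        using card_of_ordLeq by metis
      then have "card K \<le> card {a}"
        by (intro card_inj_on_le) auto
      then show False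
        using * by simp
    qed
    then show ?thesis
      by (simp add: card_of_Well_order not_ordLeq_iff_ordLess)
  qed
  then have "s z \<in> lt_power K" if "z \<in> K \<times> K" for z
    unfolding lt_power_def mem_Collect_eq s using that by (simp add: mem_Times_iff)
  then have "s ` (K \<times> K) \<subseteq> lt_power K"
    by blast
  then have "card (K \<times> K) \<le> card (lt_power K)"
    using card_inj_on_le[OF inj] \<open>finite (lt_power K)\<close> by blast
  also have "\<dots> = card K"
    using pow K \<open>finite (lt_power K)\<close> by (meson card_of_ordIso bij_betw_same_card)
  finally have "card K * card K \<le> card K * 1"
    by (simp add: card_cartesian_product)
  then show False
    using * by simp
qed

end

subsection \<open>The punctured space\<close>

text \<open>The cover is indexed by \<open>K\<close> itself, possibly with repetitions, so that the
  well-order of \<open>K\<close> drives the recursions.\<close>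

locale punctured_Parovicenko =
  fixes K :: "'k set" and X :: "'a topology" and x :: 'a and C :: "'k \<Rightarrow> 'a set"
  assumes infinite_K: "infinite K" and Parovicenko: "kappa_Parovicenko K X"
    and x: "x \<in> topspace X"
    and C_clopen: "\<And>a. a \<in> K \<Longrightarrow> clopenin X (C a)"
    and C_cover: "(\<Union>a\<in>K. C a) = topspace X - {x}"

context punctured_Parovicenko
  opening cardinal_syntax
begin

abbreviation "pX \<equiv> topspace X - {x}"
abbreviation "Y \<equiv> subtopology X pX"

lemma X_props:
  "compact_space X" "Hausdorff_space X" "zero_dimensional X" "F_kappa_space K X"
  "\<forall>z\<in>topspace X. \<not> openin X {z}"
  using Parovicenko unfolding kappa_Parovicenko_def by auto

lemma openin_pX: "openin X pX"
  using X_props(2) by (simp add: open_in_Hausdorff_delete)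

lemma topspace_Y: "topspace Y = pX"
  by auto

lemma clopenin_Y_iff: "clopenin Y D \<longleftrightarrow> D \<subseteq> pX \<and> openin X D \<and> openin X (pX - D)"
  unfolding clopenin_def closedin_def topspace_Y using openin_pX by (auto simp: openin_open_subtopology)

lemma clopenin_X_imp_Y: "clopenin X W \<Longrightarrow> x \<notin> W \<Longrightarrow> clopenin Y W"
  using clopenin_subset[of X W] openin_diff[OF openin_pX, of W] unfolding clopenin_Y_iff
  by (auto simp: clopenin_def)

text \<open>A clopen set of \<open>Y\<close> may accumulate at \<open>x\<close> and so fail to be
  closed in \<open>X\<close>; its trace on a clopen \<open>W\<close> missing \<open>x\<close> is
  closed because the complement in \<open>W\<close> is open.\<close>

lemma clopenin_Int_Y:
  assumes "clopenin Y A" "clopenin X W" "W \<subseteq> pX"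
  shows "clopenin X (A \<inter> W)"
proof -
  have "openin X (A \<inter> W)" "openin X ((pX - A) \<inter> W)"
    using assms(1)[unfolded clopenin_Y_iff] assms(2)[unfolded clopenin_def]
    by (simp_all add: openin_Int)
  moreover have "A \<inter> W = W - ((pX - A) \<inter> W)"
    using assms by auto
  ultimately show ?thesis
    using assms(2) unfolding clopenin_def by (metis closedin_diff)
qed

text \<open>Smallness is asked of the traces on the \<open>C a\<close>; \<open>A\<close> and
  \<open>B\<close> themselves may be unions of \<open>|K|\<close> many clopen sets, as in
  \<open>many_clopens\<close>.\<close>

lemma Y_separation:
  assumes AB: "A \<inter> B = {}" "A \<subseteq> pX"
    and A: "\<And>a. a \<in> K \<Longrightarrow> type_less X (A \<inter> C a) K"
    and B: "\<And>a. a \<in> K \<Longrightarrow> type_less X (B \<inter> C a) K"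
  obtains D where "clopenin Y D" "A \<subseteq> D" "D \<inter> B = {}"
proof -
  obtain D where "D \<subseteq> (\<Union>a\<in>K. C a)" "openin X D" "openin X ((\<Union>a\<in>K. C a) - D)"
    "A \<inter> (\<Union>a\<in>K. C a) \<subseteq> D" "D \<inter> B = {}"
    by (rule clopen_separation_along_cover[OF X_props(1,4) infinite_K C_clopen AB(1) A B])
  note D = this[unfolded C_cover]
  show thesis
    by (rule that[of D]) (use D AB(2) in \<open>auto simp: clopenin_Y_iff\<close>)
qed

lemma Y_level_separation:
  fixes f :: "'a \<Rightarrow> real"
  assumes f: "continuous_map Y euclideanreal f" and pq: "p < q"
  obtains D where "clopenin Y D" "{z \<in> pX. f z \<le> p} \<subseteq> D" "D \<inter> {z \<in> pX. q \<le> f z} = {}"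
proof -
  have CX: "C a \<subseteq> pX" if "a \<in> K" for a
    using C_cover that by blast
  obtain A B where AB: "A \<inter> B = {}" "A \<subseteq> pX" "{z \<in> pX. f z \<le> p} \<subseteq> A" "{z \<in> pX. q \<le> f z} \<subseteq> B"
    "\<And>D. clopenin X D \<Longrightarrow> D \<subseteq> pX \<Longrightarrow> sigma_clopen K X (A \<inter> D)"
    "\<And>D. clopenin X D \<Longrightarrow> D \<subseteq> pX \<Longrightarrow> sigma_clopen K X (B \<inter> D)"
    by (rule level_cut[OF X_props(1,3) infinite_K _ card_of_image[of C K] C_cover[symmetric] f pq])
      (use C_clopen in auto)
  obtain D where "clopenin Y D" "A \<subseteq> D" "D \<inter> B = {}"
    by (rule Y_separation[OF AB(1,2)])
      (rule sigma_clopen_type_less, rule AB(5,6)[OF C_clopen CX]; assumption)+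
  then show thesis
    using that[of D] AB(3,4) by blast
qed

section \<open>Finite intersections and common points in the punctured space\<close>

text \<open>The compact set \<open>W\<close> replaces the lost compactness of the punctured space:
  the traces on \<open>W\<close> are closed in \<open>X\<close>.\<close>

lemma compact_fip:
  assumes W: "clopenin X W" "x \<notin> W" and \<A>: "\<And>A. A \<in> \<A> \<Longrightarrow> clopenin Y A"
    and fip: "\<And>\<F>. finite \<F> \<Longrightarrow> \<F> \<subseteq> \<A> \<Longrightarrow> W \<inter> \<Inter>\<F> \<noteq> {}"
  shows "W \<inter> \<Inter>\<A> \<noteq> {}"
proof -
  have WX: "W \<subseteq> pX"
    using W clopenin_subset by blast
  have "compactin X W"
    using X_props(1) W(1) by (rule clopenin_compactin)
  moreover have "closedin X D" if D: "D \<in> (\<lambda>A. A \<inter> W) ` \<A>" for D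
  proof -
    obtain A where A: "A \<in> \<A>" "D = A \<inter> W"
      using D by blast
    have "clopenin X (A \<inter> W)"
      by (rule clopenin_Int_Y[OF \<A>[OF A(1)] W(1) WX])
    then show ?thesis
      using A(2) by (simp add: clopenin_def)
  qed
  moreover have "W \<inter> \<Inter>\<F> \<noteq> {}" if \<F>: "finite \<F>" "\<F> \<subseteq> (\<lambda>A. A \<inter> W) ` \<A>" for \<F>
  proof -
    obtain \<G> where "\<G> \<subseteq> \<A>" "finite \<G>" "\<F> = (\<lambda>A. A \<inter> W) ` \<G>"
      using finite_subset_image[OF \<F>] by blast
    then show ?thesis
      using fip[of \<G>] by auto
  qed
  ultimately have "W \<inter> \<Inter>((\<lambda>A. A \<inter> W) ` \<A>) \<noteq> {}"
    unfolding compactin_fip by metis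
  then show ?thesis
    by blast
qed

lemma common_clopen_at_point:
  assumes \<A>: "\<And>A. A \<in> \<A> \<Longrightarrow> clopenin Y A" "|\<A>| <o |K|" and "pX \<inter> \<Inter>\<A> \<noteq> {}"
  obtains V where "clopenin X V" "V \<noteq> {}" "x \<notin> V" "\<And>A. A \<in> \<A> \<Longrightarrow> V \<subseteq> A"
proof -
  obtain z where "z \<in> pX" "\<And>A. A \<in> \<A> \<Longrightarrow> z \<in> A"
    using assms(3) by blast
  then have "openin X A \<and> z \<in> A" if "A \<in> \<A>" for A
    using \<A>(1)[OF that] that unfolding clopenin_Y_iff by blast
  then show thesis
    using G_kappa_clopen_avoiding[OF Parovicenko _ _ \<A>(2), of z x] \<open>z \<in> pX\<close> that by blast
qed

text \<open>Induction on \<open>|\<A>|\<close>. If the intersection were empty, no finite intersection would be contained in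
  a compact set, and two disjoint open sets of small type could be built, both accumulating at \<open>x\<close>.
  Since disjoint open sets of small type have disjoint closures, this is impossible.\<close>
lemma Y_fip:
  assumes "\<And>A. A \<in> \<A> \<Longrightarrow> clopenin Y A" "|\<A>| <o |K|"
    and "\<And>\<F>. finite \<F> \<Longrightarrow> \<F> \<subseteq> \<A> \<Longrightarrow> pX \<inter> \<Inter>\<F> \<noteq> {}"
  shows "pX \<inter> \<Inter>\<A> \<noteq> {}"
  using assms
proof (induction \<A> rule: wf_induct_rule[OF wf_inv_image[OF wf_ordLess, of card_of]])
  case (1 \<A>)
  note clo = 1(2) and small = 1(3) and fip = 1(4)
  have IH: "pX \<inter> \<Inter>\<B> \<noteq> {}" if "|\<B>| <o |\<A>|" "\<And>B. B \<in> \<B> \<Longrightarrow> clopenin Y B"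
    "\<And>\<F>. finite \<F> \<Longrightarrow> \<F> \<subseteq> \<B> \<Longrightarrow> pX \<inter> \<Inter>\<F> \<noteq> {}" for \<B>
    by (rule 1(1)) (use that small ordLess_transitive in \<open>auto simp: in_inv_image\<close>)
  show ?case
  proof
    assume empty: "pX \<inter> \<Inter>\<A> = {}"
    \<comment> \<open>Otherwise every finite intersection from \<open>\<A>\<close> would meet
      \<open>W\<close>, and compactness of \<open>W\<close> would give a common point.\<close>
    have not_compact: "\<not> pX \<inter> \<Inter>\<F> \<subseteq> W" if W: "clopenin X W" "x \<notin> W" and \<F>: "finite \<F>" "\<F> \<subseteq> \<A>" for W \<F>
    proof
      assume sub: "pX \<inter> \<Inter>\<F> \<subseteq> W"
      have "W \<inter> \<Inter>\<A> \<noteq> {}"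
      proof (rule compact_fip[OF W clo])
        fix \<G> assume "finite \<G>" "\<G> \<subseteq> \<A>"
        then have "pX \<inter> \<Inter>(\<F> \<union> \<G>) \<noteq> {}"
          using \<F> by (intro fip) auto
        then show "W \<inter> \<Inter>\<G> \<noteq> {}"
          using sub by blast
      qed
      then show False
        using empty W clopenin_subset by blast
    qed
    have inf: "infinite \<A>"
      using fip[of \<A>] empty by blast
    let ?R = "|\<A>| - Id"
    \<comment> \<open>The two components at \<open>A\<close> are the pieces contributed to the two
      open sets. Nesting in the earlier members forces accumulation at \<open>x\<close>;
      disjointness from the earlier pairs keeps the two unions apart.\<close>
    define P where "P f A v \<longleftrightarrow> (A \<in> \<A> \<longrightarrow> clopenin X (fst v) \<and> clopenin X (snd v) \<and> fst v \<noteq> {} \<and> snd v \<noteq> {} \<and>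
      x \<notin> fst v \<union> snd v \<and> fst v \<inter> snd v = {} \<and> fst v \<union> snd v \<subseteq> A \<and>
      (\<forall>B. (B, A) \<in> ?R \<longrightarrow> fst v \<union> snd v \<subseteq> B \<and> (fst v \<union> snd v) \<inter> (fst (f B) \<union> snd (f B)) = {}))"
      for f :: "'a set \<Rightarrow> 'a set \<times> 'a set" and A and v :: "'a set \<times> 'a set"
    have "\<exists>f. \<forall>A. P f A (f A)"
    proof (rule dependent_wf_choice[OF card_order_strict_wf])
      show "P f A v = P g A v" if "\<And>B. (B, A) \<in> ?R \<Longrightarrow> f B = g B" for f g A v
        using that unfolding P_def by simp
    next
      fix A f assume ih: "\<And>B. (B, A) \<in> ?R \<Longrightarrow> P f B (f B)"
      show "\<exists>v. P f A v"
      proof (cases "A \<in> \<A>")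
        case A: True
        define I where "I = {B. (B, A) \<in> ?R}"
        define w where "w B = fst (f B) \<union> snd (f B)" for B
        \<comment> \<open>Common points of \<open>\<B>\<close> are the admissible positions for the
          new pair. \<open>\<B>\<close> has smaller cardinality than \<open>\<A>\<close>, so the
          induction hypothesis provides one.\<close>
        define \<B> where "\<B> = insert A I \<union> (\<lambda>B. pX - w B) ` I"
        have IA: "I \<subseteq> \<A>"
          unfolding I_def using card_order_strict_field by fastforce
        have w: "clopenin X (w B)" "x \<notin> w B" if "B \<in> I" for B
          using ih[of B] IA that clopenin_Un unfolding P_def w_def I_def by auto
        have wY: "clopenin Y (pX - w B)" if "B \<in> I" for B
          using clopenin_Diff[OF clopenin_topspace clopenin_X_imp_Y[OF w[OF that]]] topspace_Y by simp
        have card_I: "|I| <o |\<A>|"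
          unfolding I_def by (rule card_initial_segment_less[OF A])
        have "|{A} \<union> I| <o |\<A>|"
          by (rule card_of_Un_ordLess_infinite[OF inf card_finite_less[OF inf] card_I]) simp
        then have card_B: "|\<B>| <o |\<A>|"
          unfolding \<B>_def insert_is_Un[of A I] by (rule card_of_Un_ordLess_infinite[OF inf _ card_image_less[OF card_I]])
        have clo_B: "clopenin Y B" if "B \<in> \<B>" for B
          using that clo A IA wY unfolding \<B>_def by blast
        have "pX \<inter> \<Inter>\<B> \<noteq> {}"
        proof (rule IH[OF card_B clo_B])
          fix \<F> assume \<F>: "finite \<F>" "\<F> \<subseteq> \<B>"
          \<comment> \<open>The members of \<open>\<F>\<close> outside \<open>\<A>\<close> are
            complements of earlier choices; these choices unite to a clopen set missing
            \<open>x\<close>, which by \<open>not_compact\<close> cannot contain the intersection of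
            the rest.\<close>
          define W where "W = \<Union>((\<lambda>F. pX - F) ` (\<F> - \<A>))"
          have "clopenin X (pX - F) \<and> x \<notin> pX - F" if F: "F \<in> \<F> - \<A>" for F
          proof -
            obtain B where B: "B \<in> I" "F = pX - w B"
              using F \<F>(2) A IA unfolding \<B>_def by blast
            have "pX - F = w B"
              using B(2) w[OF B(1)] clopenin_subset by blast
            then show ?thesis
              using w[OF B(1)] by simp
          qed
          then have "clopenin X F \<and> x \<notin> F" if "F \<in> (\<lambda>F. pX - F) ` (\<F> - \<A>)" for F
            using that by blast
          then have "clopenin X W" "x \<notin> W"
            unfolding W_def using \<F>(1) by (blast intro!: clopenin_Union)+
          then have "\<not> pX \<inter> \<Inter>(\<F> \<inter> \<A>) \<subseteq> W"
            by (rule not_compact) (use \<F>(1) in auto)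
          then obtain y where y: "y \<in> pX" "y \<in> \<Inter>(\<F> \<inter> \<A>)" "y \<notin> W"
            by blast
          have "y \<in> F" if "F \<in> \<F>" for F
            using y that unfolding W_def by blast
          then show "pX \<inter> \<Inter>\<F> \<noteq> {}"
            using y(1) by blast
        qed
        then obtain V where V: "clopenin X V" "V \<noteq> {}" "x \<notin> V" "\<And>B. B \<in> \<B> \<Longrightarrow> V \<subseteq> B"
          using common_clopen_at_point[OF clo_B ordLess_transitive[OF card_B small]] by blast
        obtain v v' where v: "clopenin X v" "clopenin X v'" "v \<noteq> {}" "v' \<noteq> {}" "v \<inter> v' = {}" "v \<union> v' \<subseteq> V"
          using clopen_split[OF X_props(3,2,5) V(1,2)] by blast
        have "v \<union> v' \<subseteq> B \<and> (v \<union> v') \<inter> w B = {}" if "(B, A) \<in> ?R" for B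
          using V(4)[of B] V(4)[of "pX - w B"] v(6) that unfolding \<B>_def I_def by blast
        moreover have "v \<union> v' \<subseteq> A"
          using V(4)[of A] v(6) unfolding \<B>_def by blast
        ultimately have "P f A (v, v')"
          using v V(3) unfolding P_def w_def fst_conv snd_conv by blast
        then show ?thesis ..
      qed (auto simp: P_def)
    qed
    then obtain f where f: "\<And>A. P f A (f A)"
      by blast
    define g h where "g A = fst (f A)" and "h A = snd (f A)" for A
    have gh: "clopenin X (g A)" "clopenin X (h A)" "g A \<noteq> {}" "h A \<noteq> {}" "g A \<inter> h A = {}"
      "g A \<union> h A \<subseteq> A" if "A \<in> \<A>" for A
      using f[of A] that unfolding P_def g_def h_def by auto
    have gh_less: "g A \<union> h A \<subseteq> B" "(g A \<union> h A) \<inter> (g B \<union> h B) = {}"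
      if "(B, A) \<in> ?R" for A B
    proof -
      have "A \<in> \<A>"
        using card_order_strict_field[OF that] by simp
      then show "g A \<union> h A \<subseteq> B" "(g A \<union> h A) \<inter> (g B \<union> h B) = {}"
        using f[of A] that unfolding P_def g_def h_def by blast+
    qed
    have "type_less X (\<Union>A\<in>\<A>. g A) K" "type_less X (\<Union>A\<in>\<A>. h A) K"
      by (rule type_lessI[OF small gh(1) refl], assumption, rule type_lessI[OF small gh(2) refl])
    moreover have "g A \<inter> h B = {}" if "A \<in> \<A>" "B \<in> \<A>" for A B
      using card_order_total[OF that] gh(5)[OF that(1)] gh_less[of A B] gh_less[of B A] by blast
    then have "(\<Union>A\<in>\<A>. g A) \<inter> (\<Union>A\<in>\<A>. h A) = {}"
      by blast
    ultimately obtain D where D: "clopenin X D" "(\<Union>A\<in>\<A>. g A) \<subseteq> D" "D \<inter> (\<Union>A\<in>\<A>. h A) = {}"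
      by (rule F_kappa_clopen_separation[OF X_props(1,4) infinite_K])
    \<comment> \<open>If \<open>x \<notin> D'\<close>, the piece at the last index of a finite
      subfamily lies in \<open>D'\<close> and in all its members, and \<open>compact_fip\<close>
      yields a common point. Applied to \<open>g\<close> in \<open>D\<close> and to \<open>h\<close>
      in its complement, this puts \<open>x\<close> on both sides.\<close>
    have accumulates: "x \<in> D'" if D': "clopenin X D'"
      and k: "\<And>A. A \<in> \<A> \<Longrightarrow> k A \<noteq> {} \<and> k A \<subseteq> D' \<and> k A \<subseteq> g A \<union> h A" for D' k
    proof (rule ccontr)
      assume "x \<notin> D'"
      have "D' \<inter> \<Inter>\<A> \<noteq> {}"
      proof (rule compact_fip[OF D' \<open>x \<notin> D'\<close> clo])
        fix \<F> assume \<F>: "finite \<F>" "\<F> \<subseteq> \<A>"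
        show "D' \<inter> \<Inter>\<F> \<noteq> {}"
        proof (cases "\<F> = {}")
          case True
          obtain A where "A \<in> \<A>"
            using inf infinite_imp_nonempty by blast
          then show ?thesis
            using k[of A] True by blast
        next
          case False
          then obtain m where m: "m \<in> \<F>" "\<forall>B\<in>\<F>. B = m \<or> (B, m) \<in> ?R"
            using card_order_finite_max[OF \<F>(1) _ \<F>(2)] by blast
          have mA: "m \<in> \<A>"
            using m(1) \<F>(2) by blast
          have "g m \<union> h m \<subseteq> B" if "B \<in> \<F>" for B
            using m(2) that gh(6)[OF mA] gh_less(1)[of B m] by blast
          then show ?thesis
            using k[OF mA] by blast
        qed
      qed
      then show False
        using empty \<open>x \<notin> D'\<close> clopenin_subset[OF D'] by blast
    qed
    have "x \<in> D"
      using gh(3) D(2) by (intro accumulates[OF D(1), of g]) blast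
    moreover have "x \<in> topspace X - D"
    proof (rule accumulates[OF clopenin_Diff[OF clopenin_topspace D(1)], of h])
      fix A assume A: "A \<in> \<A>"
      show "h A \<noteq> {} \<and> h A \<subseteq> topspace X - D \<and> h A \<subseteq> g A \<union> h A"
        using gh(4)[OF A] D(3) clopenin_subset[OF gh(2)[OF A]] A by blast
    qed
    ultimately show False
      by blast
  qed
qed

lemma Y_common_clopen:
  assumes "\<And>A. A \<in> \<A> \<Longrightarrow> clopenin Y A" "|\<A>| <o |K|"
    and "\<And>\<F>. finite \<F> \<Longrightarrow> \<F> \<subseteq> \<A> \<Longrightarrow> pX \<inter> \<Inter>\<F> \<noteq> {}"
  obtains V where "clopenin X V" "V \<noteq> {}" "x \<notin> V" "\<And>A. A \<in> \<A> \<Longrightarrow> V \<subseteq> A"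
  using common_clopen_at_point[OF assms(1,2) Y_fip[OF assms]] that by blast

section \<open>Many clopen sets in the punctured space\<close>

text \<open>Disjoint nonempty clopen sets \<open>W a\<close> are chosen off the earlier
  \<open>C b\<close>. Each \<open>C b\<close> then meets few of them, so for every
  \<open>S \<subseteq> K\<close> the unions over \<open>S\<close> and over \<open>K - S\<close> are
  separated by a clopen \<open>D S\<close>, which determines \<open>S\<close>.\<close>

lemma many_clopens: "|Pow K| \<le>o |Collect (clopenin Y)|"
proof -
  let ?R = "|K| - Id"
  define P where "P f a w \<longleftrightarrow> (a \<in> K \<longrightarrow> clopenin X w \<and> w \<noteq> {} \<and> x \<notin> w \<and>
      (\<forall>b. (b, a) \<in> ?R \<longrightarrow> w \<inter> (C b \<union> f b) = {}))" for f :: "'k \<Rightarrow> 'a set" and a w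
  have xC: "x \<notin> C a" if "a \<in> K" for a
    using C_cover that by blast
  have "\<exists>f. \<forall>a. P f a (f a)"
  proof (rule dependent_wf_choice[OF card_order_strict_wf])
    show "P f a w = P g a w" if "\<And>b. (b, a) \<in> ?R \<Longrightarrow> f b = g b" for f g a w
      using that unfolding P_def by simp
  next
    fix a f assume ih: "\<And>b. (b, a) \<in> ?R \<Longrightarrow> P f b (f b)"
    show "\<exists>w. P f a w"
    proof (cases "a \<in> K")
      case a: True
      define I where "I = {b. (b, a) \<in> ?R}"
      \<comment> \<open>All these complements contain \<open>x\<close>, which is the common point
        required by the \<open>G_kappa\<close> property.\<close>
      define \<A> where "\<A> = (\<lambda>b. topspace X - (C b \<union> f b)) ` I"
      have op: "openin X A \<and> x \<in> A" if A: "A \<in> \<A>" for A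
      proof -
        obtain b where b: "b \<in> I" "A = topspace X - (C b \<union> f b)"
          using A unfolding \<A>_def by blast
        have "b \<in> K"
          using card_order_strict_field b(1) unfolding I_def by fastforce
        then have "clopenin X (f b)" "x \<notin> f b"
          using ih[of b] b(1) unfolding P_def I_def by auto
        then have "clopenin X (C b \<union> f b)" "x \<notin> C b \<union> f b"
          using clopenin_Un[OF C_clopen[OF \<open>b \<in> K\<close>]] xC[OF \<open>b \<in> K\<close>] by simp_all
        then show ?thesis
          using x b(2) unfolding clopenin_def by (auto intro: openin_diff)
      qed
      have small: "|\<A>| <o |K|"
        unfolding \<A>_def I_def by (rule card_image_less[OF card_initial_segment_less[OF a]])
      obtain w where w: "clopenin X w" "w \<noteq> {}" "x \<notin> w" "\<And>A. A \<in> \<A> \<Longrightarrow> w \<subseteq> A"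
        using G_kappa_clopen_avoiding[OF Parovicenko x op small, of x] by blast
      have "w \<inter> (C b \<union> f b) = {}" if "(b, a) \<in> ?R" for b
        using w(4)[of "topspace X - (C b \<union> f b)"] that unfolding \<A>_def I_def by blast
      then have "P f a w"
        using w(1-3) unfolding P_def by blast
      then show ?thesis ..
    qed (auto simp: P_def)
  qed
  then obtain W where W: "\<And>a. P W a (W a)"
    by blast
  have W1: "clopenin X (W a)" "W a \<noteq> {}" "x \<notin> W a" if "a \<in> K" for a
    using W[of a] that unfolding P_def by auto
  have W2: "W a \<inter> (C b \<union> W b) = {}" if "(b, a) \<in> ?R" for a b
    using W[of a] that card_order_strict_field[OF that] unfolding P_def by blast
  have WY: "W a \<subseteq> pX" if "a \<in> K" for a
    using W1(1,3)[OF that] clopenin_subset by blast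
  have W_disj: "W a \<inter> W b = {}" if "a \<in> K" "b \<in> K" "a \<noteq> b" for a b
    using card_order_total[OF that(1,2)] that(3) W2[of a b] W2[of b a] by blast
  have tl: "type_less X ((\<Union>a\<in>S. W a) \<inter> C b) K" if S: "S \<subseteq> K" and b: "b \<in> K" for S b
  proof -
    \<comment> \<open>\<open>W a\<close> avoids \<open>C b\<close> whenever \<open>b\<close>
      precedes \<open>a\<close>, so only indices up to \<open>b\<close> occur in
      \<open>I\<close>.\<close>
    define I where "I = {a \<in> S. W a \<inter> C b \<noteq> {}}"
    have "I \<subseteq> {b} \<union> {a. (a, b) \<in> ?R}"
      using card_order_total[OF b] W2[of b] S unfolding I_def by blast
    then have "|I| <o |K|"
      using card_of_Un_ordLess_infinite[OF infinite_K card_finite_less[OF infinite_K] card_initial_segment_less[OF b]]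
        card_subset_less by blast
    then show ?thesis
    proof (rule type_lessI)
      show "clopenin X (W a \<inter> C b)" if "a \<in> I" for a
        using that W1(1) C_clopen[OF b] S unfolding I_def by (blast intro: clopenin_Int)
    qed (auto simp: I_def)
  qed
  define Q where "Q S D \<longleftrightarrow> clopenin Y D \<and> (\<Union>a\<in>S. W a) \<subseteq> D \<and> D \<inter> (\<Union>a\<in>K - S. W a) = {}" for S D
  have ex: "\<exists>D. Q S D" if S: "S \<subseteq> K" for S
  proof -
    have "(\<Union>a\<in>S. W a) \<inter> (\<Union>a\<in>K - S. W a) = {}"
      using W_disj S by blast
    moreover have "(\<Union>a\<in>S. W a) \<subseteq> pX"
      using WY S by blast
    ultimately show ?thesis
      by (rule Y_separation[OF _ _ tl tl]) (use S in \<open>auto simp: Q_def\<close>)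
  qed
  define D where "D S = (SOME D. Q S D)" for S
  have D: "Q S (D S)" if "S \<subseteq> K" for S
    unfolding D_def by (rule someI_ex[OF ex[OF that]])
  have mem: "a \<in> S \<longleftrightarrow> W a \<subseteq> D S" if "S \<subseteq> K" "a \<in> K" for a S
    using D[OF that(1)] W1(2)[OF that(2)] that unfolding Q_def by blast
  have "inj_on D (Pow K)"
  proof (rule inj_onI)
    fix S T assume ST: "S \<in> Pow K" "T \<in> Pow K" "D S = D T"
    then have "a \<in> S \<longleftrightarrow> a \<in> T" if "a \<in> K" for a
      using mem[OF _ that, of S] mem[OF _ that, of T] by simp
    then show "S = T"
      using ST(1,2) by blast
  qed
  then show ?thesis
    using D by (intro card_of_ordLeqI) (auto simp: Q_def)
qed

end

subsection \<open>Its Stone-Cech compactification\<close>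

text \<open>The properties of the compactification on which the argument rests, free of the cube.
  Density and \<open>e_extend\<close> tie the clopen sets of \<open>Z\<close> to those of
  \<open>Y\<close>.\<close>

locale punctured_Parovicenko_compactification = punctured_Parovicenko K X x C
  for K :: "'k set" and X :: "'a topology" and x C +
  fixes Z :: "'z topology" and e :: "'a \<Rightarrow> 'z"
  assumes Z_compact: "compact_space Z" and Z_Hausdorff: "Hausdorff_space Z"
    and e_cont: "continuous_map Y Z e"
    and e_dense: "Z closure_of (e ` pX) = topspace Z"
    and e_extend: "\<And>f. continuous_map Y (top_of_set {0..1::real}) f \<Longrightarrow>
      \<exists>g. continuous_map Z euclideanreal g \<and> (\<forall>y\<in>pX. g (e y) = f y)"

context punctured_Parovicenko_compactification
  opening cardinal_syntax
begin

text \<open>On clopen sets \<open>tr\<close> is an order isomorphism onto the clopen sets of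
  \<open>Y\<close>: density gives injectivity in \<open>tr_subset_iff\<close>, extension of
  indicator functions gives surjectivity in \<open>clopen_extension\<close>.\<close>

definition tr :: "'z set \<Rightarrow> 'a set" where
  "tr A = {y \<in> pX. e y \<in> A}"

lemma e_image: "y \<in> pX \<Longrightarrow> e y \<in> topspace Z"
  using e_cont topspace_Y unfolding continuous_map_def by blast

lemma clopenin_tr:
  assumes "clopenin Z A"
  shows "clopenin Y (tr A)"
proof -
  have "tr A = {y \<in> topspace Y. e y \<in> A}"
    unfolding tr_def topspace_Y ..
  then show ?thesis
    using assms openin_continuous_map_preimage[OF e_cont] closedin_continuous_map_preimage[OF e_cont]
    unfolding clopenin_def by metis
qed

lemma tr_nonempty:
  assumes "openin Z U" "U \<noteq> {}"
  shows "tr U \<noteq> {}"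
proof -
  obtain z where "z \<in> U"
    using assms by blast
  then have "z \<in> Z closure_of (e ` pX)"
    unfolding e_dense using assms openin_subset by blast
  then obtain w where "w \<in> e ` pX" "w \<in> U"
    unfolding in_closure_of using assms(1) \<open>z \<in> U\<close> by blast
  then show ?thesis
    unfolding tr_def by blast
qed

lemma tr_subset_iff:
  assumes "clopenin Z A" "clopenin Z B"
  shows "tr A \<subseteq> tr B \<longleftrightarrow> A \<subseteq> B"
proof
  assume "tr A \<subseteq> tr B"
  then have "tr (A - B) = {}"
    unfolding tr_def by blast
  moreover have "openin Z (A - B)"
    using clopenin_Diff[OF assms] by (simp add: clopenin_def)
  ultimately show "A \<subseteq> B"
    using tr_nonempty by blast
qed (auto simp: tr_def)

lemma clopen_extension:
  assumes D: "clopenin Y D"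
  obtains A where "clopenin Z A" "tr A = D"
proof -
  define f where "f y = (if y \<in> D then 1 else 0::real)" for y
  have DY: "openin Y D" "openin Y (pX - D)" "D \<subseteq> pX"
    using D clopenin_subset[OF D] topspace_Y unfolding clopenin_def closedin_def by auto
  have "continuous_map Y (top_of_set {0..1}) f"
  proof (rule continuous_map_into_subtopology)
    show "continuous_map Y euclideanreal f"
      unfolding continuous_map_def
    proof (intro conjI allI impI)
      fix T :: "real set" assume "openin euclidean T"
      have "{y \<in> topspace Y. f y \<in> T} = (if 1 \<in> T then D else {}) \<union> (if 0 \<in> T then pX - D else {})"
        unfolding topspace_Y f_def using DY(3) by auto
      then show "openin Y {y \<in> topspace Y. f y \<in> T}"
        using DY(1,2) by (simp add: openin_Un)
    qed auto
  qed (auto simp: f_def)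
  then obtain g where g: "continuous_map Z euclideanreal g" "\<forall>y\<in>pX. g (e y) = f y"
    using e_extend by blast
  \<comment> \<open>The set where \<open>g\<close> is 0 or 1 is closed and contains the dense image
    of \<open>e\<close>, so \<open>g\<close> is the indicator of a clopen set.\<close>
  have g01: "g z = 0 \<or> g z = 1" if "z \<in> topspace Z" for z
  proof -
    have "closedin Z {z \<in> topspace Z. g z \<in> {0,1}}"
      by (rule closedin_continuous_map_preimage[OF g(1)]) simp
    moreover have "e ` pX \<subseteq> {z \<in> topspace Z. g z \<in> {0,1}}"
      using g(2) e_image by (auto simp: f_def)
    ultimately have "topspace Z \<subseteq> {z \<in> topspace Z. g z \<in> {0,1}}"
      unfolding e_dense[symmetric] by (metis closure_of_minimal)
    then show ?thesis
      using that by blast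
  qed
  define A where "A = {z \<in> topspace Z. g z \<in> {0<..}}"
  have "A = {z \<in> topspace Z. g z \<in> {1..}}"
    unfolding A_def using g01 by force
  then have "closedin Z A"
    using closedin_continuous_map_preimage[OF g(1), of "{1..}"] by simp
  moreover have "openin Z A"
    unfolding A_def by (rule openin_continuous_map_preimage[OF g(1)]) simp
  moreover have "tr A = D"
  proof -
    have "e y \<in> A \<longleftrightarrow> y \<in> D" if "y \<in> pX" for y
      using bspec[OF g(2) that] e_image[OF that] unfolding A_def f_def by simp
    then show ?thesis
      unfolding tr_def using DY(3) by blast
  qed
  ultimately show thesis
    using that unfolding clopenin_def by blast
qed

text \<open>For \<open>h\<close> with value 0 at \<open>z\<close> and 1 off \<open>U\<close>, a
  clopen set of \<open>Y\<close> separates the levels 1/3 and 2/3 of \<open>h \<circ> e\<close>. Its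
  extension contains \<open>z\<close> and stays in \<open>U\<close>, since an open set witnessing a
  failure would have a point of \<open>Y\<close> in its trace.\<close>

lemma zero_dimensional_Z: "is_base Z (Collect (clopenin Z))" "zero_dimensional Z"
proof -
  have *: "\<exists>A. clopenin Z A \<and> z \<in> A \<and> A \<subseteq> U" if U: "openin Z U" "z \<in> U" for U z
  proof -
    have "completely_regular_space Z"
      using Z_compact Z_Hausdorff compact_Hausdorff_or_regular_imp_normal_space
        normal_imp_completely_regular_space by blast
    moreover have "closedin Z (topspace Z - U)" "z \<in> topspace Z - (topspace Z - U)"
      using U openin_subset by auto
    ultimately obtain h :: "'z \<Rightarrow> real" where h: "continuous_map Z euclideanreal h" "h z = 0"
      "h ` (topspace Z - U) \<subseteq> {1}"
      unfolding completely_regular_space_alt by metis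
    have "continuous_map Y euclideanreal (h \<circ> e)"
      by (rule continuous_map_compose[OF e_cont h(1)])
    then obtain D where D: "clopenin Y D" "{y \<in> pX. (h \<circ> e) y \<le> 1/3} \<subseteq> D"
      "D \<inter> {y \<in> pX. 2/3 \<le> (h \<circ> e) y} = {}"
      by (rule Y_level_separation[of _ "1/3" "2/3"]) auto
    obtain A where A: "clopenin Z A" "tr A = D"
      using clopen_extension[OF D(1)] .
    have hop: "openin Z {z \<in> topspace Z. h z \<in> {..<1/3}}" "openin Z {z \<in> topspace Z. h z \<in> {2/3<..}}"
      by (rule openin_continuous_map_preimage[OF h(1)]; simp)+
    have "z \<in> A"
    proof (rule ccontr)
      assume "z \<notin> A"
      define V where "V = {z \<in> topspace Z. h z \<in> {..<1/3}} \<inter> (topspace Z - A)"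
      have "openin Z V"
        unfolding V_def using hop(1) A(1) unfolding clopenin_def by blast
      moreover have "z \<in> V"
        unfolding V_def using U openin_subset \<open>z \<notin> A\<close> h(2) by fastforce
      ultimately obtain y where "y \<in> tr V"
        using tr_nonempty by blast
      then have "y \<in> pX" "(h \<circ> e) y \<le> 1/3" "y \<notin> tr A"
        unfolding tr_def V_def by auto
      then show False
        using A(2) D(2) by blast
    qed
    moreover have "A \<subseteq> U"
    proof
      fix w assume "w \<in> A"
      show "w \<in> U"
      proof (rule ccontr)
        assume "w \<notin> U"
        define V where "V = {z \<in> topspace Z. h z \<in> {2/3<..}} \<inter> A"
        have "openin Z V"
          unfolding V_def using hop(2) A(1) unfolding clopenin_def by blast
        moreover have "w \<in> topspace Z - U"
          using \<open>w \<in> A\<close> \<open>w \<notin> U\<close> clopenin_subset[OF A(1)] by blast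
        then have "w \<in> V"
          unfolding V_def using h(3) \<open>w \<in> A\<close> by force
        ultimately obtain y where "y \<in> tr V"
          using tr_nonempty by blast
        then have "y \<in> pX" "2/3 \<le> (h \<circ> e) y" "y \<in> tr A"
          unfolding tr_def V_def by auto
        then show False
          using A(2) D(3) by blast
      qed
    qed
    ultimately show ?thesis
      using A(1) by blast
  qed
  show "is_base Z (Collect (clopenin Z))" "zero_dimensional Z"
    by (rule zero_dimensionalI; use * in blast)+
qed

lemma type_less_tr:
  assumes "type_less Z U K" "clopenin X W" "W \<subseteq> pX"
  shows "type_less X (tr U \<inter> W) K"
proof -
  obtain \<C> where \<C>: "\<forall>A\<in>\<C>. clopenin Z A" "\<Union>\<C> = U" "|\<C>| <o |K|"
    using assms(1) unfolding type_less_def by blast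
  show ?thesis
  proof (rule type_lessI[OF \<C>(3)])
    show "clopenin X (tr A \<inter> W)" if "A \<in> \<C>" for A
      using that \<C>(1) assms by (intro clopenin_Int_Y clopenin_tr) auto
    show "(\<Union>A\<in>\<C>. tr A \<inter> W) = tr U \<inter> W"
      unfolding tr_def using \<C>(2) by blast
  qed
qed

text \<open>The two sets cut out of \<open>U\<close> in \<open>Z\<close> have small type, hence so
  have their traces on the \<open>C a\<close>. A clopen set separating the traces in
  \<open>Y\<close> extends to one separating the cut sets.\<close>

lemma F_kappa_Z: "F_kappa_space K Z"
  unfolding F_kappa_space_def
proof (intro conjI allI impI)
  fix U assume "openin Z U \<and> type_less Z U K"
  then have U: "openin Z U" "type_less Z U K"
    by auto
  obtain \<C> where \<C>: "\<And>A. A \<in> \<C> \<Longrightarrow> clopenin Z A" "\<Union>\<C> = U" "|\<C>| <o |K|"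
    using U(2) unfolding type_less_def by blast
  have \<C>U: "A \<subseteq> U" if "A \<in> \<C>" for A
    using \<C>(2) that by blast
  show "C_star_embedded Z U"
  proof (rule C_star_embedded_clopen_separation[OF _ U(1)])
    show "normal_space Z"
      using Z_compact Z_Hausdorff compact_Hausdorff_or_regular_imp_normal_space by blast
  next
    fix f and p q :: real
    assume f: "continuous_map (subtopology Z U) euclideanreal f" and pq: "p < q"
    obtain A B where AB: "A \<inter> B = {}" "A \<subseteq> U" "B \<subseteq> U"
      "{z \<in> U. f z \<le> p} \<subseteq> A" "{z \<in> U. q \<le> f z} \<subseteq> B"
      "\<And>G. clopenin Z G \<Longrightarrow> G \<subseteq> U \<Longrightarrow> sigma_clopen K Z (A \<inter> G)"
      "\<And>G. clopenin Z G \<Longrightarrow> G \<subseteq> U \<Longrightarrow> sigma_clopen K Z (B \<inter> G)"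
      using level_cut[OF Z_compact zero_dimensional_Z(2) infinite_K \<C>(1) ordLess_imp_ordLeq[OF \<C>(3)]
          \<C>(2)[symmetric] f pq] by blast
    have "type_less Z (\<Union>G\<in>\<C>. A \<inter> G) K" "type_less Z (\<Union>G\<in>\<C>. B \<inter> G) K"
      by (rule type_less_UN_sigma_clopen[OF infinite_K \<C>(3)]; use AB(6,7) \<C>(1) \<C>U in blast)+
    moreover have "(\<Union>G\<in>\<C>. A \<inter> G) = A" "(\<Union>G\<in>\<C>. B \<inter> G) = B"
      using AB(2,3) \<C>(2) by auto
    ultimately have tlAB: "type_less Z A K" "type_less Z B K"
      by simp_all
    have CX: "C a \<subseteq> pX" if "a \<in> K" for a
      using C_cover that by blast
    have "tr A \<inter> tr B = {}" "tr A \<subseteq> pX"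
      using AB(1) unfolding tr_def by auto
    then obtain D where D: "clopenin Y D" "tr A \<subseteq> D" "D \<inter> tr B = {}"
      by (rule Y_separation[OF _ _ type_less_tr[OF tlAB(1) C_clopen CX] type_less_tr[OF tlAB(2) C_clopen CX]])
    obtain G where G: "clopenin Z G" "tr G = D"
      using clopen_extension[OF D(1)] .
    have "A \<subseteq> G"
    proof -
      obtain \<D> where \<D>: "\<forall>H\<in>\<D>. clopenin Z H" "\<Union>\<D> = A"
        using tlAB(1) unfolding type_less_def by blast
      have "H \<subseteq> G" if "H \<in> \<D>" for H
      proof -
        have "tr H \<subseteq> tr A"
          using \<D>(2) that unfolding tr_def by blast
        then show ?thesis
          using tr_subset_iff[of H G] \<D>(1) that G D(2) by blast
      qed
      then show ?thesis
        using \<D>(2) by blast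
    qed
    moreover have "G \<inter> B = {}"
    proof (rule ccontr)
      assume "G \<inter> B \<noteq> {}"
      moreover have "openin Z (G \<inter> B)"
        using G(1) type_less_openin[OF tlAB(2)] unfolding clopenin_def by blast
      ultimately have "tr (G \<inter> B) \<noteq> {}"
        by (rule tr_nonempty[rotated])
      then show False
        using G(2) D(3) unfolding tr_def by blast
    qed
    ultimately show "\<exists>D. clopenin Z D \<and> {z \<in> U. f z \<le> p} \<subseteq> D \<and> D \<inter> {z \<in> U. q \<le> f z} = {}"
      using G(1) AB(4,5) by blast
  qed
qed (rule zero_dimensional_Z(2))

text \<open>Shrinking each open set to a clopen one around \<open>z\<close> gives traces with the
  finite intersection property, by density. A nonempty clopen set of \<open>X\<close> inside all of
  them extends to a clopen subset of the intersection.\<close>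

lemma G_kappa_Z: "G_kappa_space K Z"
  unfolding G_kappa_space_def
proof (intro allI impI, elim conjE)
  fix \<U> assume op: "\<forall>U\<in>\<U>. openin Z U" and small: "|\<U>| <o |K|" and ne: "topspace Z \<inter> \<Inter>\<U> \<noteq> {}"
  then obtain z where z: "z \<in> topspace Z" "\<And>U. U \<in> \<U> \<Longrightarrow> z \<in> U"
    by blast
  have "\<forall>U\<in>\<U>. \<exists>A. clopenin Z A \<and> z \<in> A \<and> A \<subseteq> U"
    using zero_dimensionalD[OF zero_dimensional_Z(2)] op z(2) by metis
  from bchoice[OF this] obtain c where c: "\<forall>U\<in>\<U>. clopenin Z (c U) \<and> z \<in> c U \<and> c U \<subseteq> U" ..
  define \<A> where "\<A> = (\<lambda>U. tr (c U)) ` \<U>"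
  have clo: "clopenin Y A" if "A \<in> \<A>" for A
    using that c clopenin_tr unfolding \<A>_def by blast
  have card: "|\<A>| <o |K|"
    unfolding \<A>_def by (rule card_image_less[OF small])
  have fip: "pX \<inter> \<Inter>\<F> \<noteq> {}" if \<F>: "finite \<F>" "\<F> \<subseteq> \<A>" for \<F>
  proof -
    obtain \<G> where \<G>: "\<G> \<subseteq> \<U>" "finite \<G>" "\<F> = (\<lambda>U. tr (c U)) ` \<G>"
      using finite_subset_image[OF \<F>[unfolded \<A>_def]] by blast
    define V where "V = topspace Z \<inter> (\<Inter>U\<in>\<G>. c U)"
    have "openin Z V"
      unfolding V_def using \<G>(1,2) c
      by (intro openin_Int_Inter) (auto simp: clopenin_def)
    moreover have "z \<in> V"
      unfolding V_def using z(1) c \<G>(1) by blast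
    ultimately have "tr V \<noteq> {}"
      using tr_nonempty by blast
    then show ?thesis
      unfolding \<G>(3) V_def tr_def by blast
  qed
  obtain V where V: "clopenin X V" "V \<noteq> {}" "x \<notin> V" "\<And>A. A \<in> \<A> \<Longrightarrow> V \<subseteq> A"
    using Y_common_clopen[OF clo card fip] by blast
  obtain G where G: "clopenin Z G" "tr G = V"
    using clopen_extension[OF clopenin_X_imp_Y[OF V(1,3)]] .
  have "G \<subseteq> U" if "U \<in> \<U>" for U
  proof -
    have "tr G \<subseteq> tr (c U)"
      using V(4)[of "tr (c U)"] G(2) that unfolding \<A>_def by blast
    then show ?thesis
      using tr_subset_iff[OF G(1), of "c U"] c that by blast
  qed
  then have "G \<subseteq> Z interior_of (topspace Z \<inter> \<Inter>\<U>)"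
    using G(1) clopenin_subset[OF G(1)] by (intro interior_of_maximal) (auto simp: clopenin_def)
  moreover have "G \<noteq> {}"
    using G(2) V(2) unfolding tr_def by blast
  ultimately show "Z interior_of (topspace Z \<inter> \<Inter>\<U>) \<noteq> {}"
    by blast
qed

text \<open>A clopen singleton would make its trace minimal among nonempty clopen sets of
  \<open>Y\<close>, yet a nonempty open set of \<open>X\<close> contains two disjoint nonempty
  clopen ones.\<close>

lemma no_isolated_Z: "\<not> openin Z {z}" if "z \<in> topspace Z" for z
proof
  assume op: "openin Z {z}"
  have clo: "clopenin Z {z}"
    using op that Z_Hausdorff by (simp add: clopenin_def closedin_Hausdorff_sing_eq)
  have "tr {z} \<noteq> {}"
    by (rule tr_nonempty[OF op]) simp
  moreover have "openin X (tr {z})"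
    using clopenin_tr[OF clo] unfolding clopenin_Y_iff by blast
  ultimately obtain V where V: "clopenin X V" "V \<noteq> {}" "V \<subseteq> tr {z}" "x \<notin> V"
    using nonempty_open_clopen_avoiding[OF X_props(3,2,5)] by metis
  obtain v v' where v: "clopenin X v" "clopenin X v'" "v \<noteq> {}" "v' \<noteq> {}" "v \<inter> v' = {}" "v \<union> v' \<subseteq> V"
    using clopen_split[OF X_props(3,2,5) V(1,2)] by blast
  have "w = tr {z}" if w: "clopenin X w" "w \<noteq> {}" "w \<subseteq> V" for w
  proof -
    have "x \<notin> w"
      using V(4) w(3) by blast
    obtain A where A: "clopenin Z A" "tr A = w"
      using clopen_extension[OF clopenin_X_imp_Y[OF w(1) \<open>x \<notin> w\<close>]] .
    then have "A \<subseteq> {z}"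
      using tr_subset_iff[OF A(1) clo] w(3) V(3) by blast
    moreover have "A \<noteq> {}"
      using A(2) w(2) unfolding tr_def by blast
    ultimately have "A = {z}"
      by blast
    then show ?thesis
      using A(2) by simp
  qed
  then have "v = tr {z}" "v' = tr {z}"
    using v by blast+
  then show False
    using v(3,5) by blast
qed

lemma Parovicenko_Z: "kappa_Parovicenko K Z"
  unfolding kappa_Parovicenko_def
  using Z_compact Z_Hausdorff zero_dimensional_Z(2) F_kappa_Z G_kappa_Z no_isolated_Z by blast

text \<open>Upper bound: clopen sets of \<open>Z\<close> inject via traces into the open sets of
  \<open>X\<close>, hence number at most \<open>|Pow B|\<close>. Lower bound:
  \<open>many_clopens\<close> against the number of clopen sets that a base allows.\<close>

lemma weight_Z:
  assumes B: "is_base X B" "|B| \<le>o |K|"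
  shows "weight_is Z (Pow K)"
  unfolding weight_is_def
proof (intro conjI allI impI)
  have tr_inj: "inj_on tr (Collect (clopenin Z))"
    using tr_subset_iff by (intro inj_onI) (metis antisym mem_Collect_eq order_refl)
  have "|Collect (clopenin Z)| \<le>o |Collect (openin X)|"
    using clopenin_tr unfolding clopenin_Y_iff by (intro card_of_ordLeqI[OF tr_inj]) blast
  also have "|Collect (openin X)| \<le>o |Pow B|"
    by (rule card_open_sets_le[OF B(1)])
  also have "|Pow B| \<le>o |Pow K|"
    by (rule card_Pow_mono[OF B(2)])
  finally show "\<exists>B. is_base Z B \<and> |B| \<le>o |Pow K|"
    using zero_dimensional_Z(1) by blast
next
  fix B' assume B': "is_base Z B'"
  have "Collect (clopenin Y) \<subseteq> tr ` Collect (clopenin Z)"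
    using clopen_extension by (metis image_eqI mem_Collect_eq subsetI)
  then have le: "|Pow K| \<le>o |Collect (clopenin Z)|"
    by (rule ordLeq_transitive[OF many_clopens surj_imp_ordLeq])
  have "infinite B'"
  proof
    assume "finite B'"
    have "Collect (clopenin Z) \<subseteq> Union ` Pow B'"
      using B' unfolding is_base_def clopenin_def by blast
    then have "finite (Collect (clopenin Z))"
      using \<open>finite B'\<close> finite_subset by blast
    then have "finite (Pow K)"
      using card_of_ordLeq_finite[OF le] by blast
    then show False
      using infinite_K by simp
  qed
  then show "|Pow K| \<le>o |B'|"
    using card_clopens_le_base[OF Z_compact B'] le ordLeq_transitive by blast
qed

end

section \<open>Cech's construction in the cube\<close>

context punctured_Parovicenko
begin

lemma punctured_Parovicenko_stone_cech:
  "punctured_Parovicenko_compactification K X x C (stone_cech Y)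
     (\<lambda>y. \<lambda>f\<in>{f. continuous_map Y (top_of_set {0..1::real}) f \<and> f \<in> extensional (topspace Y)}. f y)"
proof -
  define I where "I = {f. continuous_map Y (top_of_set {0..1::real}) f \<and> f \<in> extensional (topspace Y)}"
  define P where "P = product_topology (\<lambda>_ :: 'a \<Rightarrow> real. top_of_set {0..1::real}) I"
  define e where "e y = (\<lambda>f\<in>I. f y)" for y
  define S where "S = P closure_of (e ` pX)"
  have Z: "stone_cech Y = subtopology P S"
    unfolding stone_cech_def Let_def S_def P_def e_def I_def topspace_Y restrict_def by simp
  have P: "compact_space P" "Hausdorff_space P"
    unfolding P_def
    by (auto simp: compact_space_product_topology Hausdorff_space_product_topology
        Hausdorff_space_subtopology compact_space_subtopology)
  have e_P: "continuous_map Y P e"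
    unfolding P_def continuous_map_componentwise e_def by (auto simp: I_def)
  have e_S: "e ` pX \<subseteq> S"
    unfolding S_def using continuous_map_image_subset_topspace[OF e_P] topspace_Y
    by (intro closure_of_subset) simp
  have SP: "S \<subseteq> topspace P"
    unfolding S_def by (rule closure_of_subset_topspace)
  have "punctured_Parovicenko_compactification K X x C (stone_cech Y) e"
    unfolding Z
  proof unfold_locales
    show "compact_space (subtopology P S)"
      unfolding S_def using P(1) by (simp add: closedin_compact_space compact_space_subtopology)
    show "Hausdorff_space (subtopology P S)"
      by (rule Hausdorff_space_subtopology[OF P(2)])
    show "continuous_map Y (subtopology P S) e"
      using e_P e_S topspace_Y by (intro continuous_map_into_subtopology) auto
    show "subtopology P S closure_of e ` pX = topspace (subtopology P S)"
      using e_S SP unfolding closure_of_subtopology S_def by (auto simp: Int_absorb1)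
  next
    fix f assume f: "continuous_map Y (top_of_set {0..1::real}) f"
    \<comment> \<open>Coordinates of the cube are indexed by extensional functions, so
      \<open>f\<close> is restricted first; the projection to that coordinate is the
      extension.\<close>
    define f' where "f' = restrict f pX"
    have "continuous_map Y (top_of_set {0..1::real}) f'"
      by (rule continuous_map_eq[OF f]) (auto simp: f'_def topspace_Y)
    then have "f' \<in> I"
      unfolding I_def topspace_Y by (simp add: f'_def)
    then have "continuous_map P (top_of_set {0..1::real}) (\<lambda>z. z f')"
      unfolding P_def by (rule continuous_map_product_projection)
    then have "continuous_map (subtopology P S) euclideanreal (\<lambda>z. z f')"
      by (intro continuous_map_from_subtopology) (simp add: continuous_map_in_subtopology)
    moreover have "(e y) f' = f y" if "y \<in> pX" for y
      using \<open>f' \<in> I\<close> that by (simp add: e_def f'_def)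
    ultimately show "\<exists>g. continuous_map (subtopology P S) euclideanreal g \<and> (\<forall>y\<in>pX. g (e y) = f y)"
      by blast
  qed
  then show ?thesis
    unfolding e_def I_def .
qed

end

theorem theorem5p2:
  fixes K :: "'k set" and X :: "'a topology" and x :: 'a
  assumes kappa: "ordIso2 (card_of (lt_power K)) (card_of K)"
    and S_kappa: "kappa_Parovicenko K X" "weight_is X K"
    and x: "x \<in> topspace X"
  shows "kappa_Parovicenko K (stone_cech (subtopology X (topspace X - {x}))) \<and>
         weight_is (stone_cech (subtopology X (topspace X - {x}))) (Pow K)"
proof -
  have X: "compact_space X" "Hausdorff_space X" "zero_dimensional X"
    "\<forall>z\<in>topspace X. \<not> openin X {z}"
    using S_kappa(1) unfolding kappa_Parovicenko_def by auto
  obtain B where B: "is_base X B" "ordLeq2 (card_of B) (card_of K)"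
    using S_kappa(2) unfolding weight_is_def by blast
  \<comment> \<open>For finite \<open>K\<close> the hypothesis on \<open>lt_power K\<close> leaves
    at most one element, hence a base with at most one member.\<close>
  have K: "infinite K"
  proof
    assume "finite K"
    obtain \<iota> where \<iota>: "inj_on \<iota> B" "\<iota> ` B \<subseteq> K"
      using B(2) card_of_ordLeq by metis
    have "card B \<le> card K"
      by (rule card_inj_on_le[OF \<iota> \<open>finite K\<close>])
    also have "card K \<le> Suc 0"
      using lt_power_finite[OF \<open>finite K\<close> kappa] by simp
    finally have "\<forall>a\<in>B. \<forall>b\<in>B. a = b"
      using card_le_Suc0_iff_eq[OF inj_on_finite[OF \<iota> \<open>finite K\<close>]] by simp
    then have "\<exists>b. B \<subseteq> {b}"
      by blast
    then show False
      using base_not_singleton[OF X(2,4) x B(1)] by blast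
  qed
  define \<D> where "\<D> = {D. clopenin X D \<and> x \<notin> D}"
  have "ordLeq2 (card_of \<D>) (card_of (Collect (clopenin X)))"
    unfolding \<D>_def by (intro card_of_mono1) auto
  moreover have "ordLeq2 (card_of (Collect (clopenin X))) (card_of K)"
    using card_clopens_le[OF X(1) B K] .
  \<comment> \<open>Nonemptiness turns the cardinal inequality into a surjection \<open>C\<close> of
    \<open>K\<close> onto \<open>\<D>\<close>.\<close>
  moreover have "\<D> \<noteq> {}"
    unfolding \<D>_def by (auto intro: clopenin_empty)
  ultimately obtain C where C: "C ` K = \<D>"
    using card_of_ordLeq2 ordLeq_transitive by metis
  interpret punctured_Parovicenko K X x C
  proof
    show "clopenin X (C a)" if "a \<in> K" for a
      using C that unfolding \<D>_def by blast
    have "\<exists>D\<in>\<D>. z \<in> D" if z: "z \<in> topspace X - {x}" for z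
    proof -
      have "openin X (topspace X - {x})"
        using X(2) by (simp add: open_in_Hausdorff_delete)
      then obtain D where "clopenin X D" "z \<in> D" "D \<subseteq> topspace X - {x}"
        using zero_dimensionalD[OF X(3) _ z] by blast
      then show ?thesis
        unfolding \<D>_def by blast
    qed
    moreover have "D \<subseteq> topspace X - {x}" if "D \<in> \<D>" for D
      using that clopenin_subset unfolding \<D>_def by blast
    ultimately show "(\<Union>a\<in>K. C a) = topspace X - {x}"
      unfolding C by blast
  qed (use K S_kappa x in auto)
  interpret punctured_Parovicenko_compactification K X x C "stone_cech Y"
    "\<lambda>y. \<lambda>f\<in>{f. continuous_map Y (top_of_set {0..1::real}) f \<and> f \<in> extensional (topspace Y)}. f y"
    by (rule punctured_Parovicenko_stone_cech)
  show ?thesis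
    using Parovicenko_Z weight_Z[OF B] by blast
qed

end
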